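(* Suppose that $P\subseteq\mathbb{R}^3$ is a reduced polytope. Let $F$ be a facet of $P$ with edges $a_1a_2,\ldots,a_{k-1}a_k,a_ka_1$, and let $v$ be a vertex of $P$. Suppose that, in this clockwise order, $vv_{1,1},\ldots,vv_{1,i_1},vv_{2,1},\ldots,vv_{2,i_2},\ldots,vv_{k,1},\ldots,vv_{k,i_k}$, where $k,i_1,\ldots,i_k$ are positive integers, are the edges of $P$ incident to $v$. For $j\in\{1,\ldots,k\}$ and $l\in\{1,\ldots,i_j-1\}$, let $F_{j,l}$ be the facet of $P$ incident to $vv_{j,l}$ and $vv_{j,l+1}$. For $j\in\{1,\ldots,k-1\}$, let $F_{j,i_j}$ be the facet incident to $vv_{j,i_j}$ and $vv_{j+1,1}$. Finally, let $F_{k,i_k}$ be the facet incident to $vv_{k,i_k}$ and $vv_{1,1}$. Then the following three conditions cannot all hold at the same time: (a) The facet $F$ and the vertex $v$ are strictly antipodal, and $\rho(v,F)=\omega(P)$. (b) For every $j\in\{1,\ldots,k\}$, the edges $vv_{j,1}$ and $a_{j-1}a_j$ are strictly antipodal (where $a_0=a_k$). (c) For every $j\in\{1,\ldots,k\}$, the facets $F_{j,1},\ldots,F_{j,i_j}$ are strictly antipodal to $a_j$, and moreover there is a number $l\in\{1,\ldots,i_j\}$ such that $\rho(a_j,F_{j,l})=\omega(P)$.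
   Context: $\mathbb{R}^3$ carries the standard inner product $\langle\cdot,\cdot\rangle$ and the Euclidean norm $\|\cdot\|$. A polytope is the convex hull of finitely many points; a convex body is a compact convex set with non-empty interior. For $u\in\mathbb{R}^3$ let $h(K,u)=\sup\{\langle u,x\rangle:x\in K\}$, $w(K,u)=h(K,u)+h(K,-u)$, and for $u\neq 0$ let $H(K,u)=\{x\in\mathbb{R}^3:\langle u,x\rangle=h(K,u)\}$ be the supporting hyperplane of $K$ with outer normal $u$. The minimum width is $\omega(K)=\inf\{w(K,u):\|u\|=1\}$. A convex body $K$ is reduced if $\omega(K')<\omega(K)$ for every convex body $K'\subsetneq K$. Faces of a polytope are its intersections with supporting hyperplanes; faces of affine dimension $0,1,2$ of a polytope with non-empty interior in $\mathbb{R}^3$ are its vertices, edges, facets. Faces are denoted by the list of their vertices, e.g. $xy$ is the edge with endpoints $x,y$ (a single vertex is identified with the corresponding singleton). Two distinct faces $F_1,F_2$ of $P$ are strictly antipodal if there is $u\in\mathbb{R}^3$ with $\|u\|=1$, $H(P,u)\cap P=F_1$ and $H(P,-u)\cap P=F_2$. For $A,B\subseteq\mathbb{R}^3$, $\rho(A,B)=\inf\{\|x-y\|:x\in\operatorname{aff}(A),\,y\in\operatorname{aff}(B)\}$, where $\operatorname{aff}$ denotes the affine hull. The edges incident to $v$ are listed completely, each once, in their cyclic order around $v$, so that cyclically consecutive edges lie in a common facet. The vertices of $F$ are $a_1,\ldots,a_k$ in cyclic order. *)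

theory Defs
  imports "HOL-Analysis.Analysis"
begin

definition support_fun :: "'a::euclidean_space set \<Rightarrow> 'a \<Rightarrow> real" where
  "support_fun K u = (SUP x\<in>K. u \<bullet> x)"

definition dir_width :: "'a::euclidean_space set \<Rightarrow> 'a \<Rightarrow> real" where
  "dir_width K u = support_fun K u + support_fun K (- u)"

definition support_hyperplane :: "'a::euclidean_space set \<Rightarrow> 'a \<Rightarrow> 'a set" where
  "support_hyperplane K u = {x. u \<bullet> x = support_fun K u}"

definition min_width :: "'a::euclidean_space set \<Rightarrow> real" where
  "min_width K = (INF u\<in>{u. norm u = 1}. dir_width K u)"

definition convex_body :: "'a::euclidean_space set \<Rightarrow> bool" where
  "convex_body K \<longleftrightarrow> compact K \<and> convex K \<and> interior K \<noteq> {}"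

definition reduced_body :: "'a::euclidean_space set \<Rightarrow> bool" where
  "reduced_body K \<longleftrightarrow>
     convex_body K \<and> (\<forall>K'. convex_body K' \<and> K' \<subset> K \<longrightarrow> min_width K' < min_width K)"

text \<open>Faces are cut out by supporting hyperplanes, so neither the empty set nor (for a set with
  non-empty interior) the set itself is a face; see \<open>supp_face_iff\<close> below for the comparison
  with \<open>face_of\<close>.\<close>

definition supp_face :: "'a::euclidean_space set \<Rightarrow> 'a set \<Rightarrow> bool" where
  "supp_face P G \<longleftrightarrow> (\<exists>u. u \<noteq> 0 \<and> G = support_hyperplane P u \<inter> P)"

definition is_vertex :: "(real^3) set \<Rightarrow> real^3 \<Rightarrow> bool" where
  "is_vertex P x \<longleftrightarrow> supp_face P {x}"

definition is_edge :: "(real^3) set \<Rightarrow> (real^3) set \<Rightarrow> bool" where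
  "is_edge P E \<longleftrightarrow> supp_face P E \<and> aff_dim E = 1"

definition is_facet :: "(real^3) set \<Rightarrow> (real^3) set \<Rightarrow> bool" where
  "is_facet P F \<longleftrightarrow> supp_face P F \<and> aff_dim F = 2"

definition strictly_antipodal :: "'a::euclidean_space set \<Rightarrow> 'a set \<Rightarrow> 'a set \<Rightarrow> bool" where
  "strictly_antipodal P F\<^sub>1 F\<^sub>2 \<longleftrightarrow>
     supp_face P F\<^sub>1 \<and> supp_face P F\<^sub>2 \<and> F\<^sub>1 \<noteq> F\<^sub>2 \<and>
     (\<exists>u. norm u = 1 \<and> support_hyperplane P u \<inter> P = F\<^sub>1 \<and> support_hyperplane P (- u) \<inter> P = F\<^sub>2)"

definition aff_dist :: "'a::euclidean_space set \<Rightarrow> 'a set \<Rightarrow> real" where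
  "aff_dist A B = Inf {norm (x - y) | x y. x \<in> affine hull A \<and> y \<in> affine hull B}"

lemma support_fun_eqI:
  assumes "K \<subseteq> {x. u \<bullet> x \<le> b}" "x \<in> K" "u \<bullet> x = b"
  shows "support_fun K u = b"
  unfolding support_fun_def
  by (rule cSup_eq_maximum) (use assms in auto)

lemma supp_face_iff:
  fixes P :: "'a::euclidean_space set"
  assumes P: "polytope P" and int: "interior P \<noteq> {}"
  shows "supp_face P G \<longleftrightarrow> G face_of P \<and> G \<noteq> {} \<and> G \<noteq> P"
proof
  assume "supp_face P G"
  then obtain u where u: "u \<noteq> 0" and G: "G = support_hyperplane P u \<inter> P"
    by (auto simp: supp_face_def)
  have cP: "compact P" and ne: "P \<noteq> {}" and conv: "convex P"
    using P int polytope_imp_compact polytope_imp_convex by auto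
  obtain x where x: "x \<in> P" "\<And>y. y \<in> P \<Longrightarrow> u \<bullet> y \<le> u \<bullet> x"
    using continuous_attains_sup[OF cP ne, of "\<lambda>y. u \<bullet> y"]
      continuous_on_inner[OF continuous_on_const continuous_on_id, of P u] by auto
  have h: "support_fun P u = u \<bullet> x"
    by (rule support_fun_eqI) (use x in auto)
  have Geq: "G = P \<inter> {y. u \<bullet> y = u \<bullet> x}"
    using G h by (auto simp: support_hyperplane_def)
  have "G face_of P"
    unfolding Geq by (rule face_of_Int_supporting_hyperplane_le[OF conv]) (use x in auto)
  moreover have "G \<noteq> {}" using Geq x by auto
  moreover have "G \<noteq> P"
  proof
    assume "G = P"
    then have "interior P \<subseteq> interior {y. u \<bullet> y = u \<bullet> x}"
      using Geq by (intro interior_mono) auto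
    then show False using int u by (simp add: interior_hyperplane)
  qed
  ultimately show "G face_of P \<and> G \<noteq> {} \<and> G \<noteq> P" by simp
next
  assume G: "G face_of P \<and> G \<noteq> {} \<and> G \<noteq> P"
  then have "G exposed_face_of P"
    using P by (simp add: exposed_face_of_polyhedron polytope_imp_polyhedron)
  then obtain u b where u: "u \<noteq> 0" "P \<subseteq> {x. u \<bullet> x \<le> b}" "G = P \<inter> {x. u \<bullet> x = b}"
    using G by (auto simp: exposed_face_of)
  then obtain x where "x \<in> P" "u \<bullet> x = b" using G by auto
  then have "support_fun P u = b" using u by (intro support_fun_eqI) auto
  then show "supp_face P G"
    using u unfolding supp_face_def support_hyperplane_def by (intro exI[of _ u]) auto
qed

end

theory Submission
  imports Defs
begin

text \<open>Let \<open>\<omega>\<close> be the minimum width. Since \<open>P - P\<close> contains the ball of radius \<open>\<omega>\<close>, the foot \<open>p\<close> of \<open>v\<close>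
  on the plane of \<open>F\<close> lies in \<open>F\<close>, and for every \<open>j\<close> one of the facets \<open>F\<^sub>j\<^sub>,\<^sub>l\<close> contains the point
  where its plane touches the sphere of radius \<open>\<omega>\<close> about \<open>a\<^sub>j\<close>; the planes of the other
  facets \<open>F\<^sub>j\<^sub>,\<^sub>l\<close> do not meet the interior of that sphere. For a direction \<open>d\<close> at \<open>v\<close> let \<open>\<tau>\<^sub>j d\<close> be
  the angle in a tangent plane of this sphere through the line \<open>v + \<real> d\<close> between \<open>d\<close> and the
  direction from \<open>v\<close> to the tangent point. The triangle inequality for angles shows that \<open>\<tau>\<^sub>j\<close> changes along
  a facet angle at \<open>v\<close> by at most that angle, whence the face angles of the facets \<open>F\<^sub>j\<^sub>,\<^sub>l\<close> at \<open>v\<close>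
  sum to at least \<open>\<tau>\<^sub>j (v\<^sub>j\<^sub>,\<^sub>1 - v) + \<tau>\<^sub>j (v\<^sub>j\<^sub>+\<^sub>1\<^sub>,\<^sub>1 - v)\<close>. Condition (b) gives in the same way that
  the angle \<open>a\<^sub>j\<^sub>-\<^sub>1 p a\<^sub>j\<close> is at most \<open>\<tau>\<^sub>j\<^sub>-\<^sub>1 (v\<^sub>j\<^sub>,\<^sub>1 - v) + \<tau>\<^sub>j (v\<^sub>j\<^sub>,\<^sub>1 - v)\<close>. Summing over \<open>j\<close>,
  the full angle \<open>2\<pi>\<close> around \<open>p\<close> would be at most the sum of the face angles at \<open>v\<close>, which is
  less than \<open>2\<pi>\<close>.\<close>

section \<open>Angles between vectors\<close>

text \<open>Division by zero gives 0, so an angle with the zero vector is \<open>pi / 2\<close>.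
  With this value the triangle inequality \<open>vangle_triangle\<close> needs no exception for zero
  vectors.\<close>

definition vangle :: "'a::real_inner \<Rightarrow> 'a \<Rightarrow> real" where
  "vangle x y = arccos (x \<bullet> y / (norm x * norm y))"

lemma inner_div_norms_bounds:
  fixes x y :: "'a::real_inner"
  shows "-1 \<le> x \<bullet> y / (norm x * norm y)" "x \<bullet> y / (norm x * norm y) \<le> 1"
proof -
  have "\<bar>x \<bullet> y / (norm x * norm y)\<bar> \<le> 1"
    using Cauchy_Schwarz_ineq2[of x y] by (cases "x = 0 \<or> y = 0") (auto simp: divide_le_eq_1 abs_mult)
  then show "-1 \<le> x \<bullet> y / (norm x * norm y)" "x \<bullet> y / (norm x * norm y) \<le> 1"
    by linarith+
qed

lemma vangle_bounds: "0 \<le> vangle x y" "vangle x y \<le> pi"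
  unfolding vangle_def using inner_div_norms_bounds by (blast intro: arccos_lbound arccos_ubound)+

lemma cos_vangle: "cos (vangle x y) = x \<bullet> y / (norm x * norm y)"
  unfolding vangle_def using inner_div_norms_bounds by (rule cos_arccos)

lemma vangle_commute: "vangle x y = vangle y x"
  by (simp add: vangle_def inner_commute mult.commute)

lemma vangle_refl: "x \<noteq> 0 \<Longrightarrow> vangle x x = 0"
  by (simp add: vangle_def dot_square_norm power2_eq_square)

lemma vangle_scaleR_left: "r > 0 \<Longrightarrow> vangle (r *\<^sub>R x) y = vangle x y"
  by (simp add: vangle_def)

lemma vangle_scaleR_right: "r > 0 \<Longrightarrow> vangle x (r *\<^sub>R y) = vangle x y"
  by (simp add: vangle_def)

lemma vangle_zero: "vangle 0 x = pi / 2" "vangle x 0 = pi / 2"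
  by (simp_all add: vangle_def)

lemma vangle_sgn: "vangle (sgn x) (sgn y) = vangle x y"
  by (cases "x = 0"; cases "y = 0") (simp_all add: vangle_zero sgn_div_norm vangle_scaleR_left vangle_scaleR_right)

lemma cos_vangle_unit: "norm x = 1 \<Longrightarrow> norm y = 1 \<Longrightarrow> cos (vangle x y) = x \<bullet> y"
  by (simp add: cos_vangle)

lemma norm_orthogonal_component:
  fixes x y :: "'a::real_inner"
  assumes "norm x = 1" "norm y = 1"
  shows "norm (x - (x \<bullet> y) *\<^sub>R y) = sin (vangle x y)"
proof -
  have "(norm (x - (x \<bullet> y) *\<^sub>R y))\<^sup>2 = 1 - (x \<bullet> y)\<^sup>2"
    using assms unfolding power2_norm_eq_inner
    by (simp add: inner_diff_left inner_diff_right norm_eq_1 inner_commute power2_eq_square)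
  also have "\<dots> = (sin (vangle x y))\<^sup>2"
    using assms by (simp add: cos_vangle_unit[symmetric] sin_squared_eq)
  finally show ?thesis
    using vangle_bounds[of x y] by (simp add: sin_ge_zero)
qed

lemma inner_orthogonal_components:
  fixes x y z :: "'a::real_inner"
  assumes "norm x = 1" "norm y = 1" "norm z = 1"
  shows "(x - (x \<bullet> y) *\<^sub>R y) \<bullet> (z - (z \<bullet> y) *\<^sub>R y)
           = cos (vangle x z) - cos (vangle x y) * cos (vangle y z)"
  using assms
  by (simp add: cos_vangle_unit inner_diff_left inner_diff_right norm_eq_1 inner_commute)

lemma vangle_le_of_cos_le:
  assumes "cos (\<alpha> + \<beta>) \<le> cos (vangle x z)" "0 \<le> \<alpha>" "0 \<le> \<beta>"
  shows "vangle x z \<le> \<alpha> + \<beta>"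
proof (cases "\<alpha> + \<beta> \<le> pi")
  case True
  then show ?thesis using assms cos_mono_le_eq[of "\<alpha> + \<beta>" "vangle x z"] vangle_bounds[of x z] by auto
next
  case False
  then show ?thesis using vangle_bounds[of x z] by auto
qed

text \<open>The components of \<open>x\<close> and \<open>z\<close> orthogonal to \<open>y\<close>
  have the sines of the two angles as norms. Cauchy-Schwarz for their inner product is the addition
  formula for the cosine, read as an inequality.\<close>

lemma vangle_triangle_unit:
  fixes x y z :: "'a::real_inner"
  assumes "norm x = 1" "norm y = 1" "norm z = 1"
  shows "vangle x z \<le> vangle x y + vangle y z"
proof (rule vangle_le_of_cos_le)
  have "\<bar>(x - (x \<bullet> y) *\<^sub>R y) \<bullet> (z - (z \<bullet> y) *\<^sub>R y)\<bar> \<le> sin (vangle x y) * sin (vangle y z)"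
    using Cauchy_Schwarz_ineq2[of "x - (x \<bullet> y) *\<^sub>R y" "z - (z \<bullet> y) *\<^sub>R y"] assms
    by (simp add: norm_orthogonal_component vangle_commute[of y z])
  then show "cos (vangle x y + vangle y z) \<le> cos (vangle x z)"
    using assms by (simp add: inner_orthogonal_components cos_add)
qed (simp_all add: vangle_bounds)

lemma vangle_triangle: "vangle x z \<le> vangle x y + vangle y z"
proof (cases "x = 0 \<or> y = 0 \<or> z = 0")
  case True
  then show ?thesis using vangle_bounds[of x z] vangle_bounds[of x y] vangle_bounds[of y z]
    by (auto simp: vangle_zero)
next
  case False
  then show ?thesis
    using vangle_triangle_unit[of "sgn x" "sgn y" "sgn z"] by (simp add: vangle_sgn norm_sgn)
qed

text \<open>Equality would be equality in Cauchy-Schwarz, making the components of \<open>x\<close>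
  and \<open>z\<close> orthogonal to \<open>y\<close> collinear. As \<open>u\<close> vanishes on the
  second but not on the first, the second is zero and \<open>z\<close> is a multiple of
  \<open>y\<close>.\<close>

lemma vangle_triangle_strict:
  fixes x y z u :: "'a::real_inner"
  assumes "u \<bullet> x \<noteq> 0" "u \<bullet> y = 0" "u \<bullet> z = 0" and nz: "y \<noteq> 0" "z \<noteq> 0"
    and ncol: "\<And>r. z \<noteq> r *\<^sub>R y"
  shows "vangle x z < vangle x y + vangle y z"
proof (rule ccontr)
  assume "\<not> vangle x z < vangle x y + vangle y z"
  then have eq: "vangle x z = vangle x y + vangle y z"
    using vangle_triangle[of x z y] by linarith
  define X Y Z where "X = sgn x" and "Y = sgn y" and "Z = sgn z"
  have "x \<noteq> 0" using assms by auto
  have n: "norm X = 1" "norm Y = 1" "norm Z = 1"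
    using \<open>x \<noteq> 0\<close> nz by (simp_all add: X_def Y_def Z_def norm_sgn)
  have u: "u \<bullet> X \<noteq> 0" "u \<bullet> Y = 0" "u \<bullet> Z = 0"
    using assms \<open>x \<noteq> 0\<close> by (simp_all add: X_def Y_def Z_def sgn_div_norm)
  have eq: "vangle X Z = vangle X Y + vangle Y Z"
    using eq by (simp add: X_def Y_def Z_def vangle_sgn)
  let ?a = "X - (X \<bullet> Y) *\<^sub>R Y" and ?b = "Z - (Z \<bullet> Y) *\<^sub>R Y"
  have "?a \<bullet> ?b = - (norm ?a * norm ?b)"
    using n by (simp add: inner_orthogonal_components norm_orthogonal_component eq cos_add
        vangle_commute[of Z Y])
  then have "collinear {0, ?a, ?b}"
    by (simp add: norm_cauchy_schwarz_equal[symmetric] abs_mult)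
  moreover have "u \<bullet> ?a \<noteq> 0" "u \<bullet> ?b = 0" using u by (simp_all add: inner_diff_right)
  ultimately have "?b = 0"
    by (auto simp: collinear_lemma)
  then have "Z = (Z \<bullet> Y) *\<^sub>R Y" by simp
  then have "z = (norm z * (Z \<bullet> Y) / norm y) *\<^sub>R y"
    using nz by (metis (no_types, lifting) Y_def Z_def  divide_inverse mult.commute scaleR_scaleR
        sgn_div_norm norm_eq_zero real_vector.scale_one right_inverse)
  with ncol show False by blast
qed

text \<open>The components of \<open>x\<close> and \<open>y\<close> orthogonal to
  \<open>x + y\<close> point in opposite directions, so the cosine of the angle sum is the cosine of
  the whole angle.\<close>

lemma vangle_add_le:
  fixes x y :: "'a::real_inner"
  assumes nz: "x \<noteq> 0" "y \<noteq> 0" "x + y \<noteq> 0"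
  shows "vangle x (x + y) + vangle (x + y) y \<le> vangle x y"
proof -
  define X Y W where "X = sgn x" and "Y = sgn y" and "W = sgn (x + y)"
  have n: "norm X = 1" "norm Y = 1" "norm W = 1"
    using nz by (simp_all add: X_def Y_def W_def norm_sgn)
  let ?a = "X - (X \<bullet> W) *\<^sub>R W" and ?b = "Y - (Y \<bullet> W) *\<^sub>R W"
  have x: "x = norm x *\<^sub>R X" and y: "y = norm y *\<^sub>R Y" and w: "x + y = norm (x + y) *\<^sub>R W"
    using nz by (simp_all add: X_def Y_def W_def sgn_div_norm)
  have "norm x *\<^sub>R ?a + norm y *\<^sub>R ?b
      = (norm x *\<^sub>R X + norm y *\<^sub>R Y) - ((norm x *\<^sub>R X + norm y *\<^sub>R Y) \<bullet> W) *\<^sub>R W"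
    by (simp add: algebra_simps)
  also have "\<dots> = (x + y) - ((x + y) \<bullet> W) *\<^sub>R W"
    by (simp only: x[symmetric] y[symmetric])
  also have "\<dots> = 0" by (subst (1 2) w) (use n in \<open>simp add: norm_eq_1\<close>)
  finally have ab: "?b = - (norm x / norm y) *\<^sub>R ?a"
    using nz by (metis (no_types, lifting) add.commute add_eq_0_iff divide_inverse mult.commute scaleR_scaleR norm_eq_zero real_vector.scale_one right_inverse scaleR_minus_left scaleR_minus_right)
  have nb: "norm ?b = norm x / norm y * norm ?a"
    by (subst ab) simp
  have "?a \<bullet> ?b = - (norm ?a * norm ?b)"
    unfolding nb by (subst ab) (simp add: dot_square_norm power2_eq_square)
  then have cs: "cos (vangle X Y) = cos (vangle X W + vangle W Y)"
    using n by (simp add: inner_orthogonal_components norm_orthogonal_component cos_add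
        vangle_commute[of Y W])
  \<comment> \<open>It remains to see that the angle sum is at most \<open>pi\<close>, where the
    cosine is injective. This amounts to
    \<open>0 \<le> X \<bullet> W + W \<bullet> Y\<close>.\<close>
  have "\<bar>X \<bullet> Y\<bar> \<le> 1" using Cauchy_Schwarz_ineq2[of X Y] n by simp
  then have "0 \<le> (norm x + norm y) * (1 + X \<bullet> Y)" by simp
  also have "\<dots> = (X + Y) \<bullet> (norm x *\<^sub>R X + norm y *\<^sub>R Y)"
    using n by (simp add: algebra_simps inner_commute norm_eq_1)
  also have "\<dots> = (X + Y) \<bullet> (x + y)"
    by (simp only: x[symmetric] y[symmetric])
  also have "\<dots> = norm (x + y) * ((X + Y) \<bullet> W)" by (subst w) simp
  finally have "0 \<le> X \<bullet> W + W \<bullet> Y"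
    using nz by (simp add: zero_le_mult_iff inner_add_left inner_add_right inner_commute)
  then have "cos (pi - vangle W Y) \<le> cos (vangle X W)"
    using n by (simp add: cos_vangle_unit)
  then have "vangle X W \<le> pi - vangle W Y"
    using vangle_bounds[of X W] vangle_bounds[of W Y] cos_mono_le_eq[of "pi - vangle W Y" "vangle X W"] by auto
  then have "vangle X W + vangle W Y = vangle X Y"
    using vangle_bounds[of X Y] vangle_bounds[of X W] vangle_bounds[of W Y]
    by - (rule cos_inj_pi[OF _ _ _ _ cs[symmetric]], linarith+)
  then show ?thesis by (simp add: X_def Y_def W_def vangle_sgn)
qed

lemma vangle_cone_le:
  fixes x y :: "'a::real_inner"
  assumes nz: "x \<noteq> 0" "y \<noteq> 0" "s *\<^sub>R x + t *\<^sub>R y \<noteq> 0" and st: "0 \<le> s" "0 \<le> t"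
  shows "vangle x (s *\<^sub>R x + t *\<^sub>R y) + vangle (s *\<^sub>R x + t *\<^sub>R y) y \<le> vangle x y"
proof (cases "s = 0 \<or> t = 0")
  case True
  then show ?thesis
  proof
    assume "s = 0"
    then have "t > 0" using nz st by (cases "t = 0") auto
    with \<open>s = 0\<close> show ?thesis using nz by (simp add: vangle_scaleR_left vangle_scaleR_right vangle_refl)
  next
    assume "t = 0"
    then have "s > 0" using nz st by (cases "s = 0") auto
    with \<open>t = 0\<close> show ?thesis using nz by (simp add: vangle_scaleR_left vangle_scaleR_right vangle_refl)
  qed
next
  case False
  then have "vangle (s *\<^sub>R x) (s *\<^sub>R x + t *\<^sub>R y) + vangle (s *\<^sub>R x + t *\<^sub>R y) (t *\<^sub>R y)
               \<le> vangle (s *\<^sub>R x) (t *\<^sub>R y)"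
    using nz by (intro vangle_add_le) auto
  then show ?thesis using False st by (simp add: vangle_scaleR_left vangle_scaleR_right)
qed

section \<open>Winding of planar convex polygons\<close>

lemma periodic_mod:
  fixes f :: "nat \<Rightarrow> 'a"
  assumes "\<And>m. f (m + n) = f m"
  shows "f (m mod n) = f m"
proof -
  have "f (j + q * n) = f j" for j q
    by (induction q) (simp_all add: assms add.assoc[symmetric] add.commute[of n])
  from this[of "m mod n" "m div n"] show ?thesis by simp
qed

definition det2 :: "complex \<Rightarrow> complex \<Rightarrow> real" where
  "det2 x y = Re x * Im y - Im x * Re y"

lemma det2_swap: "det2 y x = - det2 x y"
  and det2_cnj: "det2 (cnj x) (cnj y) = - det2 x y"
  by (simp_all add: det2_def algebra_simps)

text \<open>Cramer's rule: expand \<open>w\<close> in terms of \<open>x\<close> and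
  \<open>y\<close>, then pair with \<open>z\<close>.\<close>

lemma det2_expand: "det2 x y * det2 w z = det2 w y * det2 x z + det2 x w * det2 y z"
  by (simp add: det2_def algebra_simps)

lemma vangle_cnj: "vangle (cnj x) (cnj y) = vangle x y"
  by (simp add: vangle_def inner_complex_def)

text \<open>A positive determinant makes the unoriented angle an oriented one: cosine and sine of
  \<open>vangle x y\<close> are the inner product and \<open>det2 x y\<close>, each divided by the
  product of the norms.\<close>

lemma sgn_eq_sgn_times_cis_vangle:
  assumes "det2 x y > 0"
  shows "sgn y = sgn x * cis (vangle x y)" "0 < vangle x y" "vangle x y < pi"
proof -
  have nz: "x \<noteq> 0" "y \<noteq> 0" using assms by (auto simp: det2_def)
  then have nn: "norm x * norm y > 0" by simp
  have id: "(x \<bullet> y)\<^sup>2 + (det2 x y)\<^sup>2 = (norm x * norm y)\<^sup>2"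
    by (simp add: det2_def inner_complex_def power_mult_distrib cmod_power2)
      (simp add: power2_eq_square algebra_simps)
  have c: "cos (vangle x y) = x \<bullet> y / (norm x * norm y)" by (rule cos_vangle)
  have "(sin (vangle x y))\<^sup>2 = 1 - (x \<bullet> y / (norm x * norm y))\<^sup>2"
    by (simp add: sin_squared_eq c)
  also have "\<dots> = (det2 x y / (norm x * norm y))\<^sup>2"
    unfolding power_divide id[symmetric] using nn id
    by (metis (no_types, lifting) add_diff_cancel_left' diff_divide_distrib divide_self_if less_irrefl power_eq_0_iff)
  finally have s: "sin (vangle x y) = det2 x y / (norm x * norm y)"
    by (rule power2_eq_imp_eq) (use vangle_bounds[of x y] assms nn in \<open>auto intro: sin_ge_zero\<close>)
  then have sp: "sin (vangle x y) > 0" using assms nn by simp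
  then show "0 < vangle x y" "vangle x y < pi"
    using vangle_bounds[of x y] by (auto simp: less_le)
  have cis: "cis (vangle x y) = cnj x * y / (norm x * norm y)"
    by (rule complex_eqI) (simp_all add: c s det2_def inner_complex_def Re_divide_of_real Im_divide_of_real
        flip: of_real_mult)
  have "x * cnj x = of_real ((norm x)\<^sup>2)" by (simp only: complex_norm_square)
  then show "sgn y = sgn x * cis (vangle x y)"
    unfolding cis using nz
    by (simp add: sgn_div_norm scaleR_conv_of_real field_simps power2_eq_square)
qed

lemma sgn_eq_sgn_times_cis_sum:
  assumes "\<And>m. det2 (z m) (z (Suc m)) > 0"
  shows "sgn (z m) = sgn (z 0) * cis (\<Sum>i<m. vangle (z i) (z (Suc i)))"
proof (induction m)
  case (Suc m)
  then show ?case
    using sgn_eq_sgn_times_cis_vangle(1)[OF assms, of m] by (simp add: cis_mult)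
qed simp

text \<open>Rotation by the sum maps the first direction to itself, so the sum is an integer
  multiple of \<open>2 * pi\<close>; all its terms are positive.\<close>

lemma closed_angle_sum_is_multiple:
  assumes pos: "\<And>m. det2 (z m) (z (Suc m)) > 0" and n: "n > 0" "z n = z 0"
  obtains N :: nat where "N \<ge> 1" "(\<Sum>i<n. vangle (z i) (z (Suc i))) = 2 * pi * N"
proof -
  let ?S = "\<Sum>i<n. vangle (z i) (z (Suc i))"
  have "z 0 \<noteq> 0" using pos[of 0] by (auto simp: det2_def)
  then have "cis ?S = 1" using sgn_eq_sgn_times_cis_sum[of z n, OF pos] n by (simp add: sgn_zero_iff)
  then have "cos ?S = 1" by (metis cis.sel(1) one_complex.sel(1))
  then obtain k :: int where k: "?S = of_int k * 2 * pi"
    using cos_one_2pi_int[of ?S] by auto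
  have "?S > 0"
    using n sgn_eq_sgn_times_cis_vangle(2)[OF pos] by (intro sum_pos) auto
  then have "k > 0" using k by (simp add: zero_less_mult_iff)
  then show ?thesis using that[of "nat k"] k by (simp add: field_simps)
qed

lemma det2_mult_cis: "det2 (s * cis \<alpha>) (s * cis \<beta>) = (norm s)\<^sup>2 * sin (\<beta> - \<alpha>)"
  unfolding cmod_power2 by (simp add: det2_def sin_diff algebra_simps power2_eq_square)

lemma det2_of_sgn:
  assumes "sgn x = sgn b * cis \<alpha>" "sgn y = sgn b * cis \<beta>" "b \<noteq> 0"
  shows "det2 x y = norm x * norm y * sin (\<beta> - \<alpha>)"
proof -
  have "det2 (sgn x) (sgn y) = (norm (sgn b))\<^sup>2 * sin (\<beta> - \<alpha>)"
    unfolding assms(1,2) by (rule det2_mult_cis)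
  also have "\<dots> = sin (\<beta> - \<alpha>)" using assms(3) by (simp add: norm_sgn)
  finally have *: "det2 (sgn x) (sgn y) = sin (\<beta> - \<alpha>)" .
  have "det2 x y = norm x * norm y * det2 (sgn x) (sgn y)"
    by (cases "x = 0 \<or> y = 0") (auto simp: det2_def Re_sgn Im_sgn field_simps)
  with * show ?thesis by simp
qed

text \<open>If the edge directions turned around more than once, the direction of the first edge would
  be attained a second time at another vertex, which would then lie on the first edge line or
  beyond it.\<close>

lemma total_turning_le_2pi_pos:
  fixes c :: "nat \<Rightarrow> complex"
  assumes n: "n \<ge> 3" and per: "\<And>m. c (m + n) = c m"
    and left: "\<And>m i. i mod n \<noteq> m mod n \<Longrightarrow> i mod n \<noteq> Suc m mod n \<Longrightarrow>
                 det2 (c (Suc m) - c m) (c i - c m) > 0"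
  shows "(\<Sum>m<n. vangle (c (Suc m) - c m) (c (Suc (Suc m)) - c (Suc m))) \<le> 2 * pi"
proof (rule ccontr)
  assume gt: "\<not> ?thesis"
  define f where "f m = c (Suc m) - c m" for m
  define \<Phi> where "\<Phi> m = (\<Sum>i<m. vangle (f i) (f (Suc i)))" for m
  have mod_ne: "Suc m mod n \<noteq> m mod n" "Suc (Suc m) mod n \<noteq> m mod n"
    "Suc (Suc m) mod n \<noteq> Suc m mod n" for m
    using n by (auto simp: mod_Suc)
  have permod: "c (i mod n) = c i" for i
    by (rule periodic_mod[of c, OF per])
  have pos: "det2 (f m) (f (Suc m)) > 0" for m
    using left[of "Suc (Suc m)" m, OF mod_ne(2,3)] by (simp add: f_def det2_def algebra_simps)
  have weak: "det2 (f m) (c i - c (Suc m)) \<ge> 0" for m i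
  proof -
    have "det2 (f m) (c i - c m) \<ge> 0"
    proof (cases "i mod n = m mod n \<or> i mod n = Suc m mod n")
      case True
      then have "c i = c m \<or> c i = c (Suc m)" using permod by metis
      then show ?thesis by (auto simp: f_def det2_def)
    next
      case False then show ?thesis using left[of i m] by (simp add: f_def)
    qed
    then show ?thesis by (simp add: f_def det2_def algebra_simps)
  qed
  have "f n = f 0" using per[of 0] per[of 1] by (simp add: f_def)
  then obtain N :: nat where N: "\<Phi> n = 2 * pi * N"
    using closed_angle_sum_is_multiple[of f n, OF pos] n unfolding \<Phi>_def by auto
  have "\<Phi> n > 2 * pi * real 1" using gt unfolding \<Phi>_def f_def by simp
  then have "N \<ge> 2" unfolding N by simp
  then have \<Phi>n: "\<Phi> n \<ge> 4 * pi" unfolding N by (simp add: mult.commute mult_left_mono)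
  \<comment> \<open>\<open>M\<close> is the first index where the accumulated turning reaches
    \<open>2 * pi\<close>. Single turns are less than \<open>pi\<close>, so the direction of edge 0
    lies in the sector between edges \<open>M - 1\<close> and \<open>M\<close>; a total of at least
    \<open>4 * pi\<close> forces \<open>M < n\<close>.\<close>
  define M where "M = (LEAST m. 2 * pi \<le> \<Phi> m)"
  have ex: "2 * pi \<le> \<Phi> n" using \<Phi>n pi_gt_zero by linarith
  have M: "2 * pi \<le> \<Phi> M" "M \<le> n" unfolding M_def by (rule LeastI[of _ n], fact, rule Least_le, fact)
  have lt: "\<Phi> m < 2 * pi" if "m < M" for m using not_less_Least[of m "\<lambda>m. 2 * pi \<le> \<Phi> m"] that
    unfolding M_def by auto
  have step: "\<Phi> (Suc m) < \<Phi> m + pi" for m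
    using sgn_eq_sgn_times_cis_vangle(3)[OF pos, of m] by (simp add: \<Phi>_def)
  have \<Phi>0: "\<Phi> 0 = 0" by (simp add: \<Phi>_def)
  have "M \<noteq> 0" using M \<Phi>0 pi_gt_zero by (intro notI) (simp only: \<Phi>0; linarith)
  then obtain m where Mm: "M = Suc m" by (cases M) auto
  have m: "\<Phi> m < 2 * pi" "2 * pi \<le> \<Phi> (Suc m)" using lt[of m] M Mm by auto
  have "m \<noteq> 0" using m(2) step[of 0] \<Phi>0 pi_gt_zero by (intro notI) (simp only: \<Phi>0; linarith)
  have "Suc m \<noteq> n" using m step[of m] \<Phi>n pi_gt_zero by (intro notI) (simp only:; linarith)
  then have mn: "Suc m < n" using M Mm by auto
  have sg: "sgn (f i) = sgn (f 0) * cis (\<Phi> i)" for i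
    unfolding \<Phi>_def by (rule sgn_eq_sgn_times_cis_sum[of f, OF pos])
  have sg0: "sgn (f 0) = sgn (f 0) * cis (2 * pi)" by simp
  have f0: "f i \<noteq> 0" for i using pos[of i] by (auto simp: det2_def)
  have "det2 (f m) (f 0) = norm (f m) * norm (f 0) * sin (2 * pi - \<Phi> m)"
    by (rule det2_of_sgn[OF sg sg0 f0])
  then have a: "det2 (f m) (f 0) \<ge> 0" using m step[of m] by (simp only:) (intro mult_nonneg_nonneg sin_ge_zero; simp)
  have "det2 (f 0) (f (Suc m)) = norm (f 0) * norm (f (Suc m)) * sin (\<Phi> (Suc m) - 2 * pi)"
    by (rule det2_of_sgn[OF sg0 sg f0])
  then have b: "det2 (f 0) (f (Suc m)) \<ge> 0" using m step[of m] by (simp only:) (intro mult_nonneg_nonneg sin_ge_zero; simp)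
  \<comment> \<open>Vertex 0 is weakly to the left of edges \<open>m\<close> and
    \<open>Suc m\<close>, hence, seen from vertex \<open>Suc m\<close>, also of the direction
    \<open>f 0\<close> in between. But vertex \<open>Suc m\<close> is strictly to the left of edge
    0.\<close>
  let ?z = "c 0 - c (Suc m)"
  have z1: "det2 (f m) ?z \<ge> 0" by (rule weak)
  have z2: "det2 (f (Suc m)) ?z \<ge> 0"
    using weak[of "Suc m" 0] by (simp add: f_def det2_def algebra_simps)
  have "det2 (f m) (f (Suc m)) * det2 (f 0) ?z \<ge> 0"
    using a b z1 z2 by (simp add: det2_expand[of "f m" "f (Suc m)" "f 0" ?z])
  then have "det2 (f 0) ?z \<ge> 0" using pos[of m] by (simp add: zero_le_mult_iff)
  moreover have "det2 (f 0) (c (Suc m) - c 0) > 0"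
    using left[of "Suc m" 0] mn \<open>m \<noteq> 0\<close> n by (simp add: f_def)
  ultimately show False by (simp add: det2_def algebra_simps)
qed

lemma inner_orthogonal_eq_det2:
  assumes "\<nu> \<bullet> x = 0" "x \<noteq> (0::complex)"
  obtains \<kappa> where "\<And>z. \<nu> \<bullet> z = \<kappa> * det2 x z"
proof
  fix z
  have nn: "(norm x)\<^sup>2 \<noteq> 0" using assms by simp
  have "(norm x)\<^sup>2 * (\<nu> \<bullet> z) = det2 x \<nu> * det2 x z + (\<nu> \<bullet> x) * (x \<bullet> z)"
    unfolding cmod_power2 by (simp add: det2_def inner_complex_def algebra_simps power2_eq_square)
  then show "\<nu> \<bullet> z = (det2 x \<nu> / (norm x)\<^sup>2) * det2 x z"
    using assms nn by (simp add: field_simps)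
qed

text \<open>Each functional \<open>\<nu> m\<close> is a multiple of the determinant with its edge.
  Consecutive edges lie on the inner side of each other's lines, so these factors all have the same
  sign, which tells the sense of traversal.\<close>

lemma convex_polygon_orientation:
  fixes c \<nu> :: "nat \<Rightarrow> complex"
  assumes n: "n \<ge> 3"
    and edge: "\<And>m. \<nu> m \<bullet> (c (Suc m) - c m) = 0"
    and side: "\<And>m i. i mod n \<noteq> m mod n \<Longrightarrow> i mod n \<noteq> Suc m mod n \<Longrightarrow> \<nu> m \<bullet> (c i - c m) < 0"
  obtains \<sigma> :: real where "\<sigma> = 1 \<or> \<sigma> = -1"
    "\<And>m z. \<nu> m \<bullet> z < 0 \<Longrightarrow> \<sigma> * det2 (c (Suc m) - c m) z > 0"
proof -
  define f where "f m = c (Suc m) - c m" for m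
  have mod_ne: "Suc m mod n \<noteq> m mod n" "Suc (Suc m) mod n \<noteq> m mod n"
    "Suc (Suc m) mod n \<noteq> Suc m mod n" for m
    using n by (auto simp: mod_Suc)
  have s1: "\<nu> m \<bullet> f (Suc m) < 0" for m
    using side[OF mod_ne(2,3), of m] edge[of m] by (simp add: f_def inner_diff_right)
  have s2: "\<nu> (Suc m) \<bullet> f m > 0" for m
    using side[of m "Suc m", OF mod_ne(1)[symmetric] mod_ne(2)[symmetric]]
    by (simp add: f_def inner_diff_right)
  have f0: "f m \<noteq> 0" for m using s2[of m] by auto
  have "\<exists>\<kappa>. \<forall>z. \<nu> m \<bullet> z = \<kappa> * det2 (f m) z" for m
    using inner_orthogonal_eq_det2[of "\<nu> m" "f m"] edge[of m] f0[of m] unfolding f_def by metis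
  then obtain \<kappa> where \<kappa>: "\<And>m z. \<nu> m \<bullet> z = \<kappa> m * det2 (f m) z" by metis
  have "\<kappa> m * \<kappa> (Suc m) > 0" for m
  proof -
    have "\<kappa> m * det2 (f m) (f (Suc m)) < 0" "\<kappa> (Suc m) * det2 (f m) (f (Suc m)) < 0"
      using s1[of m] s2[of m] \<kappa> det2_swap[of "f m" "f (Suc m)"] by auto
    then show ?thesis by (auto simp: mult_less_0_iff zero_less_mult_iff)
  qed
  then have sg: "sgn (\<kappa> m) = sgn (\<kappa> 0)" for m
    by (induction m) (auto simp: zero_less_mult_iff, (metis sgn_pos sgn_neg)+)
  have "\<kappa> 0 \<noteq> 0" using \<open>\<kappa> 0 * \<kappa> (Suc 0) > 0\<close> by auto
  show ?thesis
  proof (rule that[of "- sgn (\<kappa> 0)"])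
    show "- sgn (\<kappa> 0) = 1 \<or> - sgn (\<kappa> 0) = -1" using \<open>\<kappa> 0 \<noteq> 0\<close> by (simp add: sgn_if)
    fix m z assume "\<nu> m \<bullet> z < 0"
    then have "\<kappa> m * det2 (f m) z < 0" by (simp add: \<kappa>)
    then have "sgn (\<kappa> m) * det2 (f m) z < 0" by (auto simp: mult_less_0_iff)
    then show "- sgn (\<kappa> 0) * det2 (c (Suc m) - c m) z > 0" unfolding sg[of m] f_def by simp
  qed
qed

lemma convex_polygon_total_turning_le:
  fixes c \<nu> :: "nat \<Rightarrow> complex"
  assumes n: "n \<ge> 3" and per: "\<And>m. c (m + n) = c m"
    and edge: "\<And>m. \<nu> m \<bullet> (c (Suc m) - c m) = 0"
    and side: "\<And>m i. i mod n \<noteq> m mod n \<Longrightarrow> i mod n \<noteq> Suc m mod n \<Longrightarrow> \<nu> m \<bullet> (c i - c m) < 0"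
  shows "(\<Sum>m<n. vangle (c (Suc m) - c m) (c (Suc (Suc m)) - c (Suc m))) \<le> 2 * pi"
proof -
  obtain \<sigma> :: real where \<sigma>: "\<sigma> = 1 \<or> \<sigma> = -1"
    "\<And>m z. \<nu> m \<bullet> z < 0 \<Longrightarrow> \<sigma> * det2 (c (Suc m) - c m) z > 0"
    using convex_polygon_orientation[of n \<nu> c, OF n edge side] by blast
  from \<sigma>(1) show ?thesis
  proof
    assume "\<sigma> = 1"
    then show ?thesis using \<sigma>(2) side by (intro total_turning_le_2pi_pos n per) auto
  next
    \<comment> \<open>Complex conjugation preserves angles and reverses orientation.\<close>
    assume "\<sigma> = -1"
    then have "det2 (cnj (c (Suc m)) - cnj (c m)) (cnj (c i) - cnj (c m)) > 0"
      if "i mod n \<noteq> m mod n" "i mod n \<noteq> Suc m mod n" for m i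
      using \<sigma>(2)[OF side[OF that]] by (simp add: det2_cnj flip: complex_cnj_diff)
    then have "(\<Sum>m<n. vangle (cnj (c (Suc m)) - cnj (c m)) (cnj (c (Suc (Suc m))) - cnj (c (Suc m)))) \<le> 2 * pi"
      using total_turning_le_2pi_pos[of n "cnj \<circ> c"] n per by simp
    then show ?thesis by (simp add: vangle_cnj flip: complex_cnj_diff)
  qed
qed

text \<open>The triangles spanned by \<open>p\<close> and the edges all have the same orientation,
  so the rays from \<open>p\<close> to the vertices turn one way and close up: their angles sum to a
  positive multiple of \<open>2 * pi\<close>.\<close>

lemma convex_polygon_angles_at_interior_point_ge:
  fixes c \<nu> :: "nat \<Rightarrow> complex" and p :: complex
  assumes n: "n \<ge> 3" and per: "\<And>m. c (m + n) = c m"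
    and edge: "\<And>m. \<nu> m \<bullet> (c (Suc m) - c m) = 0"
    and side: "\<And>m i. i mod n \<noteq> m mod n \<Longrightarrow> i mod n \<noteq> Suc m mod n \<Longrightarrow> \<nu> m \<bullet> (c i - c m) < 0"
    and int: "\<And>m. \<nu> m \<bullet> (p - c m) < 0"
  shows "2 * pi \<le> (\<Sum>m<n. vangle (c m - p) (c (Suc m) - p))"
proof -
  obtain \<sigma> :: real where \<sigma>: "\<sigma> = 1 \<or> \<sigma> = -1"
    "\<And>m z. \<nu> m \<bullet> z < 0 \<Longrightarrow> \<sigma> * det2 (c (Suc m) - c m) z > 0"
    using convex_polygon_orientation[of n \<nu> c, OF n edge side] by blast
  have p: "\<sigma> * det2 (c m - p) (c (Suc m) - p) > 0" for m
    using \<sigma>(2)[OF int[of m]] by (simp add: det2_def algebra_simps)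
  have cn: "c n = c 0" using per[of 0] by simp
  from \<sigma>(1) show ?thesis
  proof
    assume "\<sigma> = 1"
    then obtain N :: nat where "N \<ge> 1" "(\<Sum>m<n. vangle (c m - p) (c (Suc m) - p)) = 2 * pi * N"
      using closed_angle_sum_is_multiple[of "\<lambda>m. c m - p" n] p n cn by auto
    then show ?thesis by simp
  next
    assume "\<sigma> = -1"
    then have "det2 (cnj (c m - p)) (cnj (c (Suc m) - p)) > 0" for m
      unfolding det2_cnj using p[of m] by simp
    then obtain N :: nat where "N \<ge> 1"
      "(\<Sum>m<n. vangle (cnj (c m - p)) (cnj (c (Suc m) - p))) = 2 * pi * N"
      using closed_angle_sum_is_multiple[of "\<lambda>m. cnj (c m - p)" n] n cn by auto
    then show ?thesis unfolding vangle_cnj by simp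
  qed
qed

section \<open>Angle sums in three-space\<close>

text \<open>Rotate \<open>u\<close> to the third axis and drop the third coordinate. Orthogonality
  to \<open>u\<close> is asked of one argument only, so that normals which are not orthogonal to
  \<open>u\<close> can be projected too.\<close>

lemma plane_coordinates:
  fixes u :: "real^3"
  assumes "norm u = 1"
  obtains \<phi> :: "real^3 \<Rightarrow> complex" where "linear \<phi>"
    "\<And>x y. u \<bullet> y = 0 \<Longrightarrow> \<phi> x \<bullet> \<phi> y = x \<bullet> y"
proof -
  obtain g :: "real^3 \<Rightarrow> real^3" where g: "orthogonal_transformation g" "g u = axis 3 1"
  proof (rule orthogonal_transformation_exists)
    show "norm u = norm (axis 3 1 :: real^3)" using assms by (simp add: norm_axis_1)
  qed
  have lin: "linear g" using g by (simp add: orthogonal_transformation_def)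
  show ?thesis
  proof
    show "linear (\<lambda>x. Complex (g x $ 1) (g x $ 2))"
      by (rule linearI) (simp_all add: linear_add[OF lin] linear_scale[OF lin] complex_eq_iff)
    fix x y assume "u \<bullet> y = 0"
    then have "g u \<bullet> g y = 0" using g(1) by (simp add: orthogonal_transformation_def)
    then have "g y $ 3 = 0" by (simp add: g inner_axis')
    moreover have "g x \<bullet> g y = x \<bullet> y" using g by (simp add: orthogonal_transformation_def)
    ultimately show "Complex (g x $ 1) (g x $ 2) \<bullet> Complex (g y $ 1) (g y $ 2) = x \<bullet> y"
      by (simp add: inner_complex_def inner_vec_def sum_3)
  qed
qed

lemma vangle_isometry:
  assumes "f x \<bullet> f x = x \<bullet> x" "f y \<bullet> f y = y \<bullet> y" "f x \<bullet> f y = x \<bullet> y"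
  shows "vangle (f x) (f y) = vangle x y"
  using assms by (simp add: vangle_def norm_eq_sqrt_inner)

text \<open>Cut the cone by the plane where \<open>u\<close> has value 1; the section is a convex
  polygon with vertices \<open>d m\<close> and edge vectors \<open>f m\<close>. Each apex angle is
  bounded by a difference of angles between rays and edge vectors, and at each vertex the strict
  triangle inequality compares these with the turning angle of the polygon.\<close>

lemma face_angle_sum_less_2pi:
  fixes e \<nu> :: "nat \<Rightarrow> real^3" and u :: "real^3"
  assumes n: "n \<ge> 3" and per: "\<And>m. e (m + n) = e m"
    and u: "norm u = 1" "\<And>m. u \<bullet> e m > 0"
    and face: "\<And>m. \<nu> m \<bullet> e m = 0" "\<And>m. \<nu> m \<bullet> e (Suc m) = 0"
    and side: "\<And>m i. i mod n \<noteq> m mod n \<Longrightarrow> i mod n \<noteq> Suc m mod n \<Longrightarrow> \<nu> m \<bullet> e i < 0"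
  shows "(\<Sum>m<n. vangle (e m) (e (Suc m))) < 2 * pi"
proof -
  define d where "d m = (1 / (u \<bullet> e m)) *\<^sub>R e m" for m
  define f where "f m = d (Suc m) - d m" for m
  obtain \<phi> :: "real^3 \<Rightarrow> complex" where \<phi>: "linear \<phi>"
    "\<And>x y. u \<bullet> y = 0 \<Longrightarrow> \<phi> x \<bullet> \<phi> y = x \<bullet> y"
    using plane_coordinates[OF u(1)] by blast
  have e: "u \<bullet> e m \<noteq> 0" for m using u(2)[of m] by simp
  have ud: "u \<bullet> d m = 1" for m using e by (simp add: d_def)
  have uf: "u \<bullet> f m = 0" for m by (simp add: f_def inner_diff_right ud)
  have d0: "d m \<noteq> 0" for m using ud[of m] by auto
  have mod_ne: "Suc m mod n \<noteq> m mod n" "Suc (Suc m) mod n \<noteq> m mod n"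
    "Suc (Suc m) mod n \<noteq> Suc m mod n" for m
    using n by (auto simp: mod_Suc)
  have \<nu>d: "\<nu> m \<bullet> d m = 0" "\<nu> m \<bullet> d (Suc m) = 0" for m
    using face by (simp_all add: d_def)
  have \<nu>s: "\<nu> m \<bullet> d i < 0" if "i mod n \<noteq> m mod n" "i mod n \<noteq> Suc m mod n" for m i
    using side[OF that] u(2)[of i] by (simp add: d_def divide_neg_pos)
  have f_side: "\<nu> m \<bullet> f (Suc m) < 0" for m
    using \<nu>s[OF mod_ne(2,3)] \<nu>d by (simp add: f_def inner_diff_right)
  have "\<nu> (Suc m) \<bullet> f m > 0" for m
    using \<nu>s[OF mod_ne(1)[symmetric] mod_ne(2)[symmetric]] \<nu>d by (simp add: f_def inner_diff_right)
  then have f0: "f m \<noteq> 0" for m by (metis inner_zero_right less_irrefl)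
  have ncol: "f (Suc m) \<noteq> r *\<^sub>R f m" for m r
  proof
    assume "f (Suc m) = r *\<^sub>R f m"
    then have "\<nu> m \<bullet> f (Suc m) = 0" using \<nu>d by (simp add: f_def inner_diff_right)
    then show False using f_side[of m] by simp
  qed
  have perd: "d (m + n) = d m" for m by (simp add: d_def per)
  have perf: "f n = f 0" "d n = d 0" using perd[of 0] perd[of 1] by (simp_all add: f_def)
  have \<phi>f: "\<phi> (d i) - \<phi> (d j) = \<phi> (d i - d j)" for i j by (simp add: linear_diff[OF \<phi>(1)])
  have "(\<Sum>m<n. vangle (\<phi> (d (Suc m)) - \<phi> (d m)) (\<phi> (d (Suc (Suc m))) - \<phi> (d (Suc m)))) \<le> 2 * pi"
  proof (rule convex_polygon_total_turning_le[of n _ "\<lambda>m. \<phi> (\<nu> m)"])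
    show "\<phi> (\<nu> m) \<bullet> (\<phi> (d (Suc m)) - \<phi> (d m)) = 0" for m
      unfolding \<phi>f using uf[of m] \<nu>d by (simp add: \<phi>(2) f_def inner_diff_right)
    show "\<phi> (\<nu> m) \<bullet> (\<phi> (d i) - \<phi> (d m)) < 0"
      if "i mod n \<noteq> m mod n" "i mod n \<noteq> Suc m mod n" for m i
      unfolding \<phi>f using \<nu>s[OF that] \<nu>d by (simp add: \<phi>(2) inner_diff_right ud)
  qed (use n perd in auto)
  then have turning: "(\<Sum>m<n. vangle (f m) (f (Suc m))) \<le> 2 * pi"
    unfolding \<phi>f f_def[symmetric] by (simp add: vangle_isometry[of \<phi>] \<phi>(2) uf)
  define g where "g m = vangle (d m) (f m)" for m
  have "(\<Sum>m<n. vangle (e m) (e (Suc m))) = (\<Sum>m<n. vangle (d m) (d (Suc m)))"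
    unfolding d_def using u(2) by (simp add: vangle_scaleR_left vangle_scaleR_right)
  also have "\<dots> \<le> (\<Sum>m<n. g m - vangle (d (Suc m)) (f m))"
  proof (rule sum_mono)
    fix m
    show "vangle (d m) (d (Suc m)) \<le> g m - vangle (d (Suc m)) (f m)"
      using vangle_add_le[of "d m" "f m"] d0 f0 by (simp add: g_def f_def)
  qed
  \<comment> \<open>A cyclic shift brings together the two angles at the same vertex
    \<open>d (Suc m)\<close>.\<close>
  also have "\<dots> = (\<Sum>m<n. g (Suc m) - vangle (d (Suc m)) (f m))"
  proof -
    have "g 0 + (\<Sum>m<n. g (Suc m)) = (\<Sum>m<n. g m) + g n"
      by (metis sum.lessThan_Suc sum.lessThan_Suc_shift)
    moreover have "g n = g 0" by (simp add: g_def perf)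
    ultimately show ?thesis by (simp add: sum_subtractf)
  qed
  also have "\<dots> < (\<Sum>m<n. vangle (f m) (f (Suc m)))"
  proof (rule sum_strict_mono)
    fix m
    show "g (Suc m) - vangle (d (Suc m)) (f m) < vangle (f m) (f (Suc m))"
      using vangle_triangle_strict[of u "d (Suc m)" "f m" "f (Suc m)"] f0 ncol uf ud by (simp add: g_def)
  qed (use n in \<open>auto simp: lessThan_empty_iff\<close>)
  also note turning
  finally show ?thesis .
qed

lemma polygon_angle_sum_ge_2pi:
  fixes a \<nu> :: "nat \<Rightarrow> real^3" and u p :: "real^3"
  assumes n: "n \<ge> 3" and per: "\<And>m. a (m + n) = a m"
    and u: "norm u = 1" "\<And>m. u \<bullet> (a m - p) = 0"
    and edge: "\<And>m. \<nu> m \<bullet> (a (Suc m) - a m) = 0"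
    and side: "\<And>m i. i mod n \<noteq> m mod n \<Longrightarrow> i mod n \<noteq> Suc m mod n \<Longrightarrow> \<nu> m \<bullet> (a i - a m) < 0"
    and int: "\<And>m. \<nu> m \<bullet> (p - a m) < 0"
  shows "2 * pi \<le> (\<Sum>m<n. vangle (a m - p) (a (Suc m) - p))"
proof -
  obtain \<phi> :: "real^3 \<Rightarrow> complex" where \<phi>: "linear \<phi>"
    "\<And>x y. u \<bullet> y = 0 \<Longrightarrow> \<phi> x \<bullet> \<phi> y = x \<bullet> y"
    using plane_coordinates[OF u(1)] by blast
  have \<phi>d: "\<phi> x - \<phi> y = \<phi> (x - y)" for x y by (simp add: linear_diff[OF \<phi>(1)])
  have ua: "u \<bullet> (a i - a j) = 0" "u \<bullet> (p - a j) = 0" for i j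
    using u(2)[of i] u(2)[of j] by (simp_all add: inner_diff_right)
  have "2 * pi \<le> (\<Sum>m<n. vangle (\<phi> (a m) - \<phi> p) (\<phi> (a (Suc m)) - \<phi> p))"
    by (rule convex_polygon_angles_at_interior_point_ge[of n _ "\<lambda>m. \<phi> (\<nu> m)"])
      (use n per edge side int ua in \<open>auto simp: \<phi>d \<phi>(2)\<close>)
  then show ?thesis unfolding \<phi>d by (simp add: vangle_isometry[of \<phi>] \<phi>(2) u(2))
qed

section \<open>Tangent angles\<close>

text \<open>\<open>tangent_angle \<omega> c d\<close> is the angle between \<open>d\<close> and a tangent point of the sphere of radius \<open>\<omega>\<close>
  about \<open>c\<close>, measured in a plane tangent to the sphere that contains the line through \<open>0\<close> and \<open>d\<close>.
  For \<open>d\<close> in a plane through \<open>0\<close> with normal \<open>n\<close> missing the open ball it is the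
  angle between \<open>d\<close> and the fixed vector \<open>tangent_lift \<omega> n c\<close>, so that the spherical triangle
  inequality applies.\<close>

definition tangent_angle :: "real \<Rightarrow> 'a::real_inner \<Rightarrow> 'a \<Rightarrow> real" where
  "tangent_angle \<omega> c d = arccos (d \<bullet> c / (norm d * sqrt ((norm c)\<^sup>2 - \<omega>\<^sup>2)))"

definition tangent_lift :: "real \<Rightarrow> 'a::real_inner \<Rightarrow> 'a \<Rightarrow> 'a" where
  "tangent_lift \<omega> n c = c + (sqrt ((n \<bullet> c)\<^sup>2 - \<omega>\<^sup>2) - n \<bullet> c) *\<^sub>R n"

text \<open>The lift replaces the component \<open>n \<bullet> c\<close> along \<open>n\<close> by
  the root of \<open>(n \<bullet> c)\<^sup>2 - \<omega>\<^sup>2\<close>, which lowers the squared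
  norm by \<open>\<omega>\<^sup>2\<close>.\<close>

lemma norm_tangent_lift:
  assumes "norm n = 1" "0 \<le> \<omega>" "\<omega> \<le> \<bar>n \<bullet> c\<bar>"
  shows "norm (tangent_lift \<omega> n c) = sqrt ((norm c)\<^sup>2 - \<omega>\<^sup>2)"
proof -
  let ?q = "sqrt ((n \<bullet> c)\<^sup>2 - \<omega>\<^sup>2)"
  have "\<omega>\<^sup>2 \<le> (n \<bullet> c)\<^sup>2" using assms abs_le_square_iff[of \<omega> "n \<bullet> c"] by simp
  then have q: "?q\<^sup>2 = (n \<bullet> c)\<^sup>2 - \<omega>\<^sup>2" by simp
  have "(norm (tangent_lift \<omega> n c))\<^sup>2 = (norm c)\<^sup>2 + ?q\<^sup>2 - (n \<bullet> c)\<^sup>2"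
    using assms(1) unfolding power2_norm_eq_inner tangent_lift_def
    by (simp add: inner_add_left inner_add_right norm_eq_1 inner_commute[of c n] power2_eq_square algebra_simps)
  also have "\<dots> = (norm c)\<^sup>2 - \<omega>\<^sup>2" unfolding q by simp
  finally show ?thesis by (metis norm_ge_zero real_sqrt_unique)
qed

lemma tangent_angle_eq_vangle:
  assumes "norm n = 1" "0 \<le> \<omega>" "\<omega> \<le> \<bar>n \<bullet> c\<bar>" "n \<bullet> d = 0"
  shows "tangent_angle \<omega> c d = vangle d (tangent_lift \<omega> n c)"
proof -
  have "d \<bullet> tangent_lift \<omega> n c = d \<bullet> c"
    using assms(4) by (simp add: tangent_lift_def inner_add_right inner_commute)
  then show ?thesis by (simp add: tangent_angle_def vangle_def norm_tangent_lift[OF assms(1-3)])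
qed

lemma tangent_angle_lipschitz:
  assumes "norm n = 1" "0 \<le> \<omega>" "\<omega> \<le> \<bar>n \<bullet> c\<bar>" "n \<bullet> d\<^sub>1 = 0" "n \<bullet> d\<^sub>2 = 0"
  shows "tangent_angle \<omega> c d\<^sub>1 \<le> vangle d\<^sub>1 d\<^sub>2 + tangent_angle \<omega> c d\<^sub>2"
  using assms vangle_triangle by (simp add: tangent_angle_eq_vangle)

text \<open>The hypotheses say that \<open>d\<close> is itself a tangent point seen from the origin,
  so the argument of \<open>arccos\<close> is 1.\<close>

lemma tangent_angle_touching:
  assumes "(norm d)\<^sup>2 = (norm c)\<^sup>2 - \<omega>\<^sup>2" "d \<bullet> c = (norm d)\<^sup>2" "d \<noteq> 0"
  shows "tangent_angle \<omega> c d = 0"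
  unfolding tangent_angle_def assms(1)[symmetric] assms(2) using assms(3)
  by (simp add: power2_eq_square)

text \<open>Lifting \<open>c\<^sub>1\<close> and \<open>c\<^sub>2\<close> along \<open>n\<close> yields a triangle \<open>0, c\<^sub>1*, c\<^sub>2*\<close> congruent to \<open>0, z\<^sub>1, z\<^sub>2\<close>.\<close>

lemma vangle_le_tangent_angles:
  fixes n d :: "'a::real_inner"
  assumes n: "norm n = 1" "0 \<le> \<omega>" "\<omega> \<le> \<bar>n \<bullet> c\<^sub>1\<bar>" "n \<bullet> c\<^sub>1 = n \<bullet> c\<^sub>2" "n \<bullet> d = 0"
    and z: "(norm z\<^sub>1)\<^sup>2 = (norm c\<^sub>1)\<^sup>2 - \<omega>\<^sup>2" "(norm z\<^sub>2)\<^sup>2 = (norm c\<^sub>2)\<^sup>2 - \<omega>\<^sup>2" "z\<^sub>1 - z\<^sub>2 = c\<^sub>1 - c\<^sub>2"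
  shows "vangle z\<^sub>1 z\<^sub>2 \<le> tangent_angle \<omega> c\<^sub>1 d + tangent_angle \<omega> c\<^sub>2 d"
proof -
  let ?C = "tangent_lift \<omega> n"
  have N: "norm (?C c\<^sub>1) = norm z\<^sub>1" "norm (?C c\<^sub>2) = norm z\<^sub>2"
    using n by (simp_all add: norm_tangent_lift flip: z(1,2))
  have "?C c\<^sub>1 - ?C c\<^sub>2 = z\<^sub>1 - z\<^sub>2" using n z by (simp add: tangent_lift_def)
  then have "(norm (?C c\<^sub>1 - ?C c\<^sub>2))\<^sup>2 = (norm (z\<^sub>1 - z\<^sub>2))\<^sup>2" by simp
  then have "(norm (?C c\<^sub>1))\<^sup>2 + (norm (?C c\<^sub>2))\<^sup>2 - 2 * (?C c\<^sub>1 \<bullet> ?C c\<^sub>2) =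
      (norm z\<^sub>1)\<^sup>2 + (norm z\<^sub>2)\<^sup>2 - 2 * (z\<^sub>1 \<bullet> z\<^sub>2)"
    unfolding power2_norm_eq_inner by (simp add: inner_diff_left inner_diff_right inner_commute)
  then have "?C c\<^sub>1 \<bullet> ?C c\<^sub>2 = z\<^sub>1 \<bullet> z\<^sub>2" using N by simp
  then have "vangle z\<^sub>1 z\<^sub>2 = vangle (?C c\<^sub>1) (?C c\<^sub>2)" by (simp add: vangle_def N)
  also have "\<dots> \<le> vangle (?C c\<^sub>1) d + vangle d (?C c\<^sub>2)" by (rule vangle_triangle)
  also have "\<dots> = tangent_angle \<omega> c\<^sub>1 d + tangent_angle \<omega> c\<^sub>2 d"
    using n by (simp add: tangent_angle_eq_vangle[of n] vangle_commute)
  finally show ?thesis .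
qed

text \<open>Telescope from both ends towards the index \<open>l\<close>, whose single term
  \<open>A l\<close> pays for both of its endpoints.\<close>

lemma chain_endpoints_le_sum:
  fixes t A :: "nat \<Rightarrow> real"
  assumes l: "l \<in> {1..m}" "t l + t (Suc l) \<le> A l"
    and down: "\<And>i. i \<in> {1..m} \<Longrightarrow> t i \<le> A i + t (Suc i)"
    and up: "\<And>i. i \<in> {1..m} \<Longrightarrow> t (Suc i) \<le> A i + t i"
  shows "t 1 + t (Suc m) \<le> (\<Sum>i = 1..m. A i)"
proof -
  have left: "t 1 \<le> (\<Sum>i = 1..<j. A i) + t j" if "1 \<le> j" "j \<le> Suc m" for j
    using that
  proof (induction j rule: nat_induct_at_least)
    case (Suc j) then show ?case using down[of j] by (simp add: sum.atLeastLessThan_Suc)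
  qed simp
  have right: "t (Suc j) \<le> (\<Sum>i = Suc l..j. A i) + t (Suc l)" if "l \<le> j" "j \<le> m" for j
    using that
  proof (induction j rule: nat_induct_at_least)
    case (Suc j) then show ?case using up[of "Suc j"] by simp
  qed simp
  have "(\<Sum>i = 1..m. A i) = (\<Sum>i = 1..<l. A i) + A l + (\<Sum>i = Suc l..m. A i)"
  proof -
    have "{1..m} = {1..<l} \<union> ({l} \<union> {Suc l..m})" using l by auto
    moreover have "sum A ({1..<l} \<union> {Suc l..m}) = sum A {1..<l} + sum A {Suc l..m}"
      by (rule sum.union_disjoint) auto
    ultimately show ?thesis by simp
  qed
  then show ?thesis using left[of l] right[of m] l by auto
qed

section \<open>Widths, antipodal faces and edges at a vertex\<close>

lemma support_fun_attained:
  fixes P :: "'a::euclidean_space set"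
  assumes "compact P" "P \<noteq> {}"
  obtains x where "x \<in> P" "u \<bullet> x = support_fun P u" "\<And>y. y \<in> P \<Longrightarrow> u \<bullet> y \<le> support_fun P u"
proof -
  obtain x where x: "x \<in> P" "\<And>y. y \<in> P \<Longrightarrow> u \<bullet> y \<le> u \<bullet> x"
    using continuous_attains_sup[OF assms, of "\<lambda>y. u \<bullet> y"]
      continuous_on_inner[OF continuous_on_const continuous_on_id, of P u] by auto
  then have "support_fun P u = u \<bullet> x" by (intro support_fun_eqI) auto
  with x that show ?thesis by metis
qed

lemma inner_le_support_fun:
  assumes "compact P" "x \<in> P"
  shows "u \<bullet> x \<le> support_fun P u"
  using support_fun_attained[of P u] assms by blast

lemma dir_width_attained:
  assumes "compact P" "P \<noteq> {}"
  obtains x y where "x \<in> P" "y \<in> P" "u \<bullet> (x - y) = dir_width P u"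
proof -
  obtain x y where "x \<in> P" "u \<bullet> x = support_fun P u" "y \<in> P" "- u \<bullet> y = support_fun P (- u)"
    using support_fun_attained[OF assms] by metis
  then show ?thesis using that[of x y] by (simp add: dir_width_def inner_diff_right)
qed

lemma inner_diff_le_dir_width:
  assumes "compact P" "x \<in> P" "y \<in> P"
  shows "u \<bullet> (x - y) \<le> dir_width P u"
  using inner_le_support_fun[OF assms(1,2), of u] inner_le_support_fun[OF assms(1,3), of "- u"]
  by (simp add: dir_width_def inner_diff_right)

lemma dir_width_nonneg:
  assumes "compact P" "P \<noteq> {}"
  shows "0 \<le> dir_width P u"
  using inner_diff_le_dir_width[OF assms(1)] assms(2) by (metis diff_self ex_in_conv inner_zero_right)

lemma min_width_le_dir_width:
  assumes "compact P" "P \<noteq> {}" "norm u = 1"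
  shows "min_width P \<le> dir_width P u"
  unfolding min_width_def
  by (rule cINF_lower) (use assms dir_width_nonneg in \<open>auto intro!: bdd_belowI2[of _ 0]\<close>)

lemma min_width_nonneg:
  fixes P :: "'a::euclidean_space set"
  assumes "compact P" "P \<noteq> {}"
  shows "0 \<le> min_width P"
proof -
  obtain b :: 'a where "norm b = 1" using vector_choose_size[of 1] by auto
  then show ?thesis unfolding min_width_def
    by (intro cINF_greatest) (use assms dir_width_nonneg in auto)
qed

text \<open>\<open>P - P\<close> contains the ball of radius \<open>min_width P\<close> about the origin.\<close>

lemma min_width_chord:
  fixes P :: "'a::euclidean_space set"
  assumes P: "compact P" "convex P" "P \<noteq> {}" and u: "norm u = 1"
  obtains x y where "x \<in> P" "y \<in> P" "x - y = min_width P *\<^sub>R u"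
proof (rule ccontr)
  assume no: "\<not> thesis"
  define D where "D = (\<Union>x\<in>P. \<Union>y\<in>P. {x - y})"
  let ?z = "min_width P *\<^sub>R u"
  have z: "?z \<notin> D"
  proof
    assume "?z \<in> D"
    then obtain x y where "x \<in> P" "y \<in> P" "x - y = ?z" unfolding D_def by force
    with that no show False by blast
  qed
  have "compact D"
    using compact_differences[OF P(1) P(1)] by (rule back_subst[of compact]) (auto simp: D_def)
  moreover have "convex D" unfolding D_def by (rule convex_differences[OF P(2) P(2)])
  ultimately obtain a b where ab: "a \<bullet> ?z < b" "\<And>x. x \<in> D \<Longrightarrow> b < a \<bullet> x"
    using separating_hyperplane_closed_point[of D ?z] z compact_imp_closed by blast
  obtain x0 where "x0 \<in> P" using P by auto
  then have "0 \<in> D" unfolding D_def by force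
  then have "a \<noteq> 0" using ab by force
  \<comment> \<open>The separating normal is reversed and normalised, so that all differences of
    points of \<open>P\<close> have smaller inner product with \<open>n\<close> than
    \<open>?z\<close>. The width in direction \<open>n\<close> is then too small.\<close>
  define n where "n = (- 1 / norm a) *\<^sub>R a"
  have n: "norm n = 1" using \<open>a \<noteq> 0\<close> by (simp add: n_def)
  obtain x y where xy: "x \<in> P" "y \<in> P" "n \<bullet> (x - y) = dir_width P n"
    using dir_width_attained[OF P(1,3)] by metis
  then have "x - y \<in> D" by (auto simp: D_def)
  then have "a \<bullet> ?z < a \<bullet> (x - y)" using ab by force
  then have "n \<bullet> (x - y) < n \<bullet> ?z" using \<open>a \<noteq> 0\<close> by (simp add: n_def divide_strict_right_mono)
  also have "\<dots> \<le> norm n * norm ?z" by (rule norm_cauchy_schwarz)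
  also have "\<dots> = min_width P" using n u min_width_nonneg[OF P(1,3)] by simp
  finally show False using xy(3) min_width_le_dir_width[OF P(1,3) n] by simp
qed

text \<open>This names the direction whose existence strict antipodality asserts; it is the outer
  normal at \<open>A\<close> and the inner one at \<open>B\<close>.\<close>

definition antipodal_normal :: "'a::euclidean_space set \<Rightarrow> 'a set \<Rightarrow> 'a set \<Rightarrow> 'a \<Rightarrow> bool" where
  "antipodal_normal P A B u \<longleftrightarrow>
     norm u = 1 \<and> support_hyperplane P u \<inter> P = A \<and> support_hyperplane P (- u) \<inter> P = B"

lemma antipodal_normalD:
  assumes P: "compact P" "P \<noteq> {}" and u: "antipodal_normal P A B u"
  shows antipodal_normal_norm: "norm u = 1"
    and antipodal_normal_subset: "A \<subseteq> P" "B \<subseteq> P"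
    and antipodal_normal_width: "\<And>x y. x \<in> A \<Longrightarrow> y \<in> B \<Longrightarrow> u \<bullet> (x - y) = dir_width P u"
    and antipodal_normal_widthD:
      "\<And>x y. x \<in> P \<Longrightarrow> y \<in> P \<Longrightarrow> u \<bullet> (x - y) = dir_width P u \<Longrightarrow> x \<in> A \<and> y \<in> B"
    and antipodal_normal_eq: "\<And>x y. x \<in> A \<Longrightarrow> y \<in> A \<Longrightarrow> u \<bullet> (x - y) = 0"
      "\<And>x y. x \<in> B \<Longrightarrow> y \<in> B \<Longrightarrow> u \<bullet> (x - y) = 0"
    and antipodal_normal_less: "\<And>x y. x \<in> A \<Longrightarrow> y \<in> P \<Longrightarrow> y \<notin> A \<Longrightarrow> u \<bullet> (y - x) < 0"
      "\<And>x y. x \<in> B \<Longrightarrow> y \<in> P \<Longrightarrow> y \<notin> B \<Longrightarrow> u \<bullet> (y - x) > 0"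
    and antipodal_normal_ge_min_width:
      "\<And>x y. x \<in> A \<Longrightarrow> y \<in> B \<Longrightarrow> min_width P \<le> u \<bullet> (x - y)"
proof -
  have u: "norm u = 1" "A = {x \<in> P. u \<bullet> x = support_fun P u}"
    "B = {x \<in> P. - (u \<bullet> x) = support_fun P (- u)}"
    using u by (auto simp: antipodal_normal_def support_hyperplane_def)
  have le: "u \<bullet> x \<le> support_fun P u" "- (u \<bullet> x) \<le> support_fun P (- u)" if "x \<in> P" for x
    using inner_le_support_fun[OF P(1) that, of u] inner_le_support_fun[OF P(1) that, of "- u"]
    by simp_all
  show "norm u = 1" by fact
  show "A \<subseteq> P" "B \<subseteq> P" using u by auto
  show w: "u \<bullet> (x - y) = dir_width P u" if "x \<in> A" "y \<in> B" for x y
    using that u by (auto simp: dir_width_def inner_diff_right)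
  show "x \<in> A \<and> y \<in> B" if "x \<in> P" "y \<in> P" "u \<bullet> (x - y) = dir_width P u" for x y
    using that u(2,3) le(1)[of x] le(2)[of y] by (auto simp: dir_width_def inner_diff_right)
  show "u \<bullet> (x - y) = 0" if "x \<in> A" "y \<in> A" for x y
    using that u by (auto simp: inner_diff_right)
  show "u \<bullet> (x - y) = 0" if "x \<in> B" "y \<in> B" for x y
    using that u by (auto simp: inner_diff_right)
  show "u \<bullet> (y - x) < 0" if "x \<in> A" "y \<in> P" "y \<notin> A" for x y
    using that u le(1)[of y] by (auto simp: inner_diff_right)
  show "u \<bullet> (y - x) > 0" if "x \<in> B" "y \<in> P" "y \<notin> B" for x y
    using that u le(2)[of y] by (auto simp: inner_diff_right)
  show "min_width P \<le> u \<bullet> (x - y)" if "x \<in> A" "y \<in> B" for x y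
    using w[OF that] min_width_le_dir_width[OF P u(1)] by simp
qed

lemma strictly_antipodal_normal:
  assumes "strictly_antipodal P A B"
  shows "\<exists>u. antipodal_normal P A B u"
  using assms by (auto simp: strictly_antipodal_def antipodal_normal_def)

text \<open>The affine hull of \<open>A\<close> lies in a support plane, so its distance from
  \<open>b\<close> is at least the width in direction \<open>u\<close>, which therefore equals the
  minimum width. The chord from \<open>min_width_chord\<close> attains this width and must join
  \<open>b\<close> to a point of \<open>A\<close>.\<close>

lemma antipodal_foot:
  fixes P :: "'a::euclidean_space set"
  assumes P: "compact P" "convex P" "P \<noteq> {}" and u: "antipodal_normal P A {b} u"
    and dist: "aff_dist {b} A = min_width P"
  shows "b + min_width P *\<^sub>R u \<in> A"
proof -
  note D = antipodal_normalD[OF P(1,3) u]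
  obtain x0 where x0: "x0 \<in> A"
    using dir_width_attained[OF P(1,3)] D(5) by metis
  have hull: "u \<bullet> (y - b) = dir_width P u" if "y \<in> affine hull A" for y
  proof -
    have "affine hull A \<subseteq> {y. u \<bullet> y = u \<bullet> b + dir_width P u}"
      by (rule hull_minimal) (use D(4) in \<open>auto simp: affine_hyperplane inner_diff_right algebra_simps\<close>)
    then show ?thesis using that by (auto simp: inner_diff_right)
  qed
  have "dir_width P u \<le> aff_dist {b} A"
    unfolding aff_dist_def
  proof (rule cInf_greatest)
    show "{norm (x - y) |x y. x \<in> affine hull {b} \<and> y \<in> affine hull A} \<noteq> {}"
      using hull_inc[OF x0, of affine] by auto
    fix t assume "t \<in> {norm (x - y) |x y. x \<in> affine hull {b} \<and> y \<in> affine hull A}"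
    then obtain y where y: "y \<in> affine hull A" "t = norm (y - b)"
      by (auto simp: norm_minus_commute)
    then show "dir_width P u \<le> t"
      using hull[of y] norm_cauchy_schwarz[of u "y - b"] D(1) by simp
  qed
  then have w: "dir_width P u = min_width P"
    using dist min_width_le_dir_width[OF P(1,3) D(1)] by simp
  obtain x y where xy: "x \<in> P" "y \<in> P" "x - y = min_width P *\<^sub>R u"
    using min_width_chord[OF P D(1)] by blast
  then have "u \<bullet> (x - y) = dir_width P u" using D(1) w by (simp add: norm_eq_1)
  then have "x \<in> A" "y = b" using D(5)[OF xy(1,2)] by auto
  then show ?thesis using xy(3) by (metis add.commute diff_add_cancel)
qed

lemma edge_normal:
  assumes P: "compact P" "P \<noteq> {}" and e: "is_edge P (closed_segment v w)"
  obtains \<nu> where "\<nu> \<bullet> (w - v) = 0"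
    "\<And>x. x \<in> P \<Longrightarrow> x \<notin> closed_segment v w \<Longrightarrow> \<nu> \<bullet> (x - v) < 0"
proof -
  obtain \<nu> where \<nu>: "closed_segment v w = support_hyperplane P \<nu> \<inter> P"
    using e unfolding is_edge_def supp_face_def by blast
  have eq: "closed_segment v w = {x \<in> P. \<nu> \<bullet> x = support_fun P \<nu>}"
    unfolding \<nu> by (auto simp: support_hyperplane_def)
  then have "\<nu> \<bullet> v = support_fun P \<nu>" "\<nu> \<bullet> w = support_fun P \<nu>"
    by (metis (mono_tags, lifting) ends_in_segment mem_Collect_eq)+
  moreover have "\<nu> \<bullet> x < support_fun P \<nu>" if "x \<in> P" "x \<notin> closed_segment v w" for x
    using that inner_le_support_fun[OF P(1) that(1), of \<nu>] unfolding eq by auto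
  ultimately show ?thesis using that[of \<nu>] by (auto simp: inner_diff_right)
qed

text \<open>Otherwise one edge would be a proper face of the other and have smaller
  dimension.\<close>

lemma edge_endpoint_notin_edge:
  assumes P: "polytope P" "interior P \<noteq> {}"
    and e: "is_edge P (closed_segment v w\<^sub>1)" "is_edge P (closed_segment v w\<^sub>2)"
    and ne: "closed_segment v w\<^sub>1 \<noteq> closed_segment v w\<^sub>2"
  shows "w\<^sub>1 \<notin> closed_segment v w\<^sub>2"
proof
  assume "w\<^sub>1 \<in> closed_segment v w\<^sub>2"
  then have sub: "closed_segment v w\<^sub>1 \<subseteq> closed_segment v w\<^sub>2"
    by (simp add: closed_segment_subset)
  have f: "closed_segment v w\<^sub>1 face_of P" "closed_segment v w\<^sub>2 face_of P"
    using e supp_face_iff[OF P] by (auto simp: is_edge_def)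
  then have "closed_segment v w\<^sub>1 face_of closed_segment v w\<^sub>2"
    using sub by (meson face_of_imp_subset face_of_subset)
  then have "aff_dim (closed_segment v w\<^sub>1) < aff_dim (closed_segment v w\<^sub>2)"
    using ne by (intro face_of_aff_dim_lt) auto
  then show False using e by (simp add: is_edge_def)
qed

text \<open>The two edge directions span the plane orthogonal to \<open>n\<close>. A supporting
  normal of one edge vanishes on that edge and is negative on the other, which gives the sign of the
  other coefficient.\<close>

lemma facet_in_cone_of_edges:
  fixes P :: "(real^3) set"
  assumes P: "polytope P" "interior P \<noteq> {}"
    and e: "is_edge P (closed_segment v w\<^sub>1)" "is_edge P (closed_segment v w\<^sub>2)"
    and ne: "closed_segment v w\<^sub>1 \<noteq> closed_segment v w\<^sub>2"
    and n: "n \<noteq> 0" "n \<bullet> (w\<^sub>1 - v) = 0" "n \<bullet> (w\<^sub>2 - v) = 0"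
    and y: "y \<in> P" "n \<bullet> (y - v) = 0"
  obtains s t where "0 \<le> s" "0 \<le> t" "y - v = s *\<^sub>R (w\<^sub>1 - v) + t *\<^sub>R (w\<^sub>2 - v)"
proof -
  have P': "compact P" "P \<noteq> {}" using P polytope_imp_compact by auto
  have wP: "w\<^sub>1 \<in> P" "w\<^sub>2 \<in> P"
    using e unfolding is_edge_def supp_face_def by (metis IntD2 ends_in_segment(2))+
  have ni: "w\<^sub>1 \<notin> closed_segment v w\<^sub>2" "w\<^sub>2 \<notin> closed_segment v w\<^sub>1"
    using edge_endpoint_notin_edge[OF P] e ne by metis+
  obtain \<nu>1 where \<nu>1: "\<nu>1 \<bullet> (w\<^sub>1 - v) = 0"
    "\<And>x. x \<in> P \<Longrightarrow> x \<notin> closed_segment v w\<^sub>1 \<Longrightarrow> \<nu>1 \<bullet> (x - v) < 0"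
    using edge_normal[OF P' e(1)] by blast
  obtain \<nu>2 where \<nu>2: "\<nu>2 \<bullet> (w\<^sub>2 - v) = 0"
    "\<And>x. x \<in> P \<Longrightarrow> x \<notin> closed_segment v w\<^sub>2 \<Longrightarrow> \<nu>2 \<bullet> (x - v) < 0"
    using edge_normal[OF P' e(2)] by blast
  let ?p = "w\<^sub>1 - v" and ?q = "w\<^sub>2 - v"
  have lt: "\<nu>1 \<bullet> ?q < 0" "\<nu>2 \<bullet> ?p < 0" using \<nu>1(2) \<nu>2(2) wP ni by auto
  have le: "\<nu>1 \<bullet> (y - v) \<le> 0" "\<nu>2 \<bullet> (y - v) \<le> 0"
  proof -
    have "\<nu> \<bullet> (z - v) = 0" if w0: "\<nu> \<bullet> (w - v) = 0" and zs: "z \<in> closed_segment v w" for \<nu> w z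
    proof -
      obtain c where "z = v + c *\<^sub>R (w - v)"
        using zs by (auto simp: in_segment algebra_simps)
      then show ?thesis using w0 by simp
    qed
    then show "\<nu>1 \<bullet> (y - v) \<le> 0" "\<nu>2 \<bullet> (y - v) \<le> 0"
      using \<nu>1 \<nu>2 y(1) by (metis less_eq_real_def)+
  qed
  have "?p \<noteq> ?q" using lt \<nu>1 by auto
  have "independent {?p, ?q}"
  proof -
    have "?p \<noteq> 0" using lt by auto
    moreover have "?q \<noteq> 0" "?p \<notin> span {?q}"
      using lt \<nu>2(1) by (auto simp: span_singleton)
    ultimately show ?thesis by (simp add: independent_insert)
  qed
  then have "dim {?p, ?q} = 2" using \<open>?p \<noteq> ?q\<close> dim_eq_card_independent by fastforce
  moreover have "dim {x. n \<bullet> x = 0} = 2" using dim_hyperplane[OF n(1)] by simp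
  moreover have sub: "span {?p, ?q} \<subseteq> {x. n \<bullet> x = 0}"
    by (rule span_minimal) (use n subspace_hyperplane in auto)
  ultimately have "span {?p, ?q} = {x. n \<bullet> x = 0}"
    by (intro subspace_dim_equal) (auto simp: subspace_hyperplane)
  then have "y - v \<in> span {?p, ?q}" using y by auto
  then obtain s where "y - v - s *\<^sub>R ?p \<in> span {?q}" using span_breakdown_eq by blast
  then obtain t where "y - v - s *\<^sub>R ?p = t *\<^sub>R ?q" by (auto simp: span_singleton)
  then have st: "y - v = s *\<^sub>R ?p + t *\<^sub>R ?q" by (simp add: algebra_simps)
  have "t * (\<nu>1 \<bullet> ?q) \<le> 0" "s * (\<nu>2 \<bullet> ?p) \<le> 0"
    using le unfolding st by (simp_all add: inner_add_right \<nu>1(1) \<nu>2(1))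
  then have "0 \<le> t" "0 \<le> s" using lt by (auto simp: mult_le_0_iff)
  with st that show ?thesis by blast
qed

text \<open>The third direction would be a nonnegative combination of the other two. A supporting
  normal of the third edge is negative on both and zero on their combination, so both coefficients
  vanish.\<close>

lemma third_edge_not_in_facet_plane:
  fixes P :: "(real^3) set"
  assumes P: "polytope P" "interior P \<noteq> {}"
    and e: "is_edge P (closed_segment v w\<^sub>1)" "is_edge P (closed_segment v w\<^sub>2)"
      "is_edge P (closed_segment v w\<^sub>3)"
    and ne: "closed_segment v w\<^sub>1 \<noteq> closed_segment v w\<^sub>2" "closed_segment v w\<^sub>3 \<noteq> closed_segment v w\<^sub>1"
      "closed_segment v w\<^sub>3 \<noteq> closed_segment v w\<^sub>2"
    and n: "n \<noteq> 0" "n \<bullet> (w\<^sub>1 - v) = 0" "n \<bullet> (w\<^sub>2 - v) = 0"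
  shows "n \<bullet> (w\<^sub>3 - v) \<noteq> 0"
proof
  assume z: "n \<bullet> (w\<^sub>3 - v) = 0"
  have P': "compact P" "P \<noteq> {}" using P polytope_imp_compact by auto
  have wP: "w\<^sub>1 \<in> P" "w\<^sub>2 \<in> P" "w\<^sub>3 \<in> P"
    using e unfolding is_edge_def supp_face_def by (metis IntD2 ends_in_segment(2))+
  have ni: "w\<^sub>1 \<notin> closed_segment v w\<^sub>3" "w\<^sub>2 \<notin> closed_segment v w\<^sub>3" "w\<^sub>3 \<notin> closed_segment v w\<^sub>1"
    using edge_endpoint_notin_edge[OF P] e ne by metis+
  obtain s t where st: "0 \<le> s" "0 \<le> t" "w\<^sub>3 - v = s *\<^sub>R (w\<^sub>1 - v) + t *\<^sub>R (w\<^sub>2 - v)"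
    using facet_in_cone_of_edges[OF P e(1,2) ne(1) n wP(3) z] by blast
  obtain \<nu> where \<nu>: "\<nu> \<bullet> (w\<^sub>3 - v) = 0"
    "\<And>x. x \<in> P \<Longrightarrow> x \<notin> closed_segment v w\<^sub>3 \<Longrightarrow> \<nu> \<bullet> (x - v) < 0"
    using edge_normal[OF P' e(3)] by blast
  have lt: "\<nu> \<bullet> (w\<^sub>1 - v) < 0" "\<nu> \<bullet> (w\<^sub>2 - v) < 0" using \<nu>(2) wP ni by auto
  have "s * (\<nu> \<bullet> (w\<^sub>1 - v)) + t * (\<nu> \<bullet> (w\<^sub>2 - v)) = 0"
    using \<nu>(1) unfolding st(3) by (simp add: inner_add_right)
  moreover have "s * (\<nu> \<bullet> (w\<^sub>1 - v)) \<le> 0" "t * (\<nu> \<bullet> (w\<^sub>2 - v)) \<le> 0"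
    using st lt by (simp_all add: mult_nonneg_nonpos)
  ultimately have "s * (\<nu> \<bullet> (w\<^sub>1 - v)) = 0" "t * (\<nu> \<bullet> (w\<^sub>2 - v)) = 0" by linarith+
  then have "s = 0" "t = 0" using lt by auto
  then have "w\<^sub>3 = v" using st(3) by simp
  then show False using ni(3) by simp
qed

section \<open>Cyclic enumeration of the edges at the vertex\<close>

text \<open>With this cyclic successor, the facet \<open>G j l\<close> always lies between the edge
  of index \<open>(j, l)\<close> and that of its successor, also at the end of a block and at the
  final wrap.\<close>

fun next_index :: "nat \<Rightarrow> (nat \<Rightarrow> nat) \<Rightarrow> nat \<times> nat \<Rightarrow> nat \<times> nat" where
  "next_index k i (j, l) = (if l < i j then (j, Suc l) else if j < k then (Suc j, 1) else (1, 1))"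

definition cyc_index :: "nat \<Rightarrow> (nat \<Rightarrow> nat) \<Rightarrow> nat \<Rightarrow> nat \<times> nat" where
  "cyc_index k i m = (next_index k i ^^ m) (1, 1)"

lemma cyc_index_0: "cyc_index k i 0 = (1, 1)"
  and cyc_index_Suc: "cyc_index k i (Suc m) = next_index k i (cyc_index k i m)"
  by (simp_all add: cyc_index_def)

lemma cyc_index_offset:
  assumes pos: "\<And>j. j \<in> {1..k} \<Longrightarrow> i j > 0" and j: "j \<in> {1..k}"
  shows "l < i j \<Longrightarrow> cyc_index k i ((\<Sum>x = 1..<j. i x) + l) = (j, Suc l)"
proof -
  have inner: "cyc_index k i (s + l) = (j, Suc l)"
    if "cyc_index k i s = (j, 1)" "l < i j" for s j l
    using that by (induction l) (simp_all add: cyc_index_Suc)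
  have start: "cyc_index k i (\<Sum>x = 1..<j. i x) = (j, 1)"
    using j
  proof (induction j rule: nat_induct)
    case (Suc j)
    show ?case
    proof (cases "j = 0")
      case False
      then have j: "j \<in> {1..k}" "j < k" using Suc.prems by auto
      obtain r where r: "i j = Suc r" using pos[OF j(1)] by (cases "i j") auto
      have "cyc_index k i ((\<Sum>x = 1..<j. i x) + r) = (j, Suc r)"
        using Suc.IH[OF j(1)] r by (intro inner) auto
      then have "cyc_index k i (Suc ((\<Sum>x = 1..<j. i x) + r)) = (Suc j, 1)"
        using j r by (simp add: cyc_index_Suc)
      then show ?thesis using False r by (simp add: sum.atLeastLessThan_Suc)
    qed (simp add: cyc_index_0)
  qed simp
  show "cyc_index k i ((\<Sum>x = 1..<j. i x) + l) = (j, Suc l)" if "l < i j"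
    using inner[OF start that] .
qed

lemma cyc_index_period:
  assumes k: "k > 0" and pos: "\<And>j. j \<in> {1..k} \<Longrightarrow> i j > 0"
  shows "cyc_index k i (m + (\<Sum>x = 1..k. i x)) = cyc_index k i m"
proof (induction m)
  case 0
  have kk: "k \<in> {1..k}" using k by simp
  obtain r where r: "i k = Suc r" using pos[OF kk] by (cases "i k") auto
  have "cyc_index k i ((\<Sum>x = 1..<k. i x) + r) = (k, Suc r)"
    by (rule cyc_index_offset[OF pos kk]) (simp_all add: r)
  then have "cyc_index k i (Suc ((\<Sum>x = 1..<k. i x) + r)) = (1, 1)"
    using r by (simp add: cyc_index_Suc)
  moreover have "(\<Sum>x = 1..k. i x) = Suc ((\<Sum>x = 1..<k. i x) + r)"
    using k r by (simp add: sum.last_plus)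
  ultimately show ?case by (simp add: cyc_index_0)
qed (simp add: cyc_index_Suc)

lemma next_index_mem:
  assumes k: "k > 0" and pos: "\<And>j. j \<in> {1..k} \<Longrightarrow> i j > 0"
    and x: "x \<in> (SIGMA j:{1..k}. {1..i j})"
  shows "next_index k i x \<in> (SIGMA j:{1..k}. {1..i j})"
  using x k pos by (cases x) (auto simp: Suc_le_eq)

lemma cyc_index_mem:
  assumes k: "k > 0" and pos: "\<And>j. j \<in> {1..k} \<Longrightarrow> i j > 0"
  shows "cyc_index k i m \<in> (SIGMA j:{1..k}. {1..i j})"
proof (induction m)
  case 0 then show ?case using k pos[of 1] by (auto simp: cyc_index_0 Suc_le_eq)
next
  case (Suc m)
  show ?case unfolding cyc_index_Suc by (rule next_index_mem[OF k _ Suc.IH]) (rule pos)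
qed

text \<open>Surjectivity follows from the explicit positions in \<open>cyc_index_offset\<close>,
  injectivity from equal cardinalities.\<close>

lemma bij_betw_cyc_index:
  assumes k: "k > 0" and pos: "\<And>j. j \<in> {1..k} \<Longrightarrow> i j > 0"
  shows "bij_betw (cyc_index k i) {..<\<Sum>x = 1..k. i x} (SIGMA j:{1..k}. {1..i j})"
proof -
  let ?n = "\<Sum>x = 1..k. i x" and ?S = "SIGMA j:{1..k}. {1..i j}"
  have "?S \<subseteq> cyc_index k i ` {..<?n}"
  proof clarify
    fix j l assume jl: "j \<in> {1..k}" "l \<in> {1..i j}"
    have "(\<Sum>x = 1..<j. i x) + i j = (\<Sum>x = 1..<Suc j. i x)" using jl by (simp add: sum.atLeastLessThan_Suc)
    also have "\<dots> \<le> ?n" by (rule sum_mono2) (use jl in auto)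
    finally have "(\<Sum>x = 1..<j. i x) + (l - 1) < ?n" using jl by auto
    moreover have "cyc_index k i ((\<Sum>x = 1..<j. i x) + (l - 1)) = (j, l)"
      using cyc_index_offset[of k i j "l - 1", OF pos jl(1)] jl by auto
    ultimately show "(j, l) \<in> cyc_index k i ` {..<?n}" by (metis imageI lessThan_iff)
  qed
  then have im: "cyc_index k i ` {..<?n} = ?S" using cyc_index_mem[of k i, OF k pos] by blast
  have "card ?S = ?n" by simp
  then have "inj_on (cyc_index k i) {..<?n}"
    unfolding im[symmetric] by (intro eq_card_imp_inj_on) simp_all
  with im show ?thesis by (simp add: bij_betw_def)
qed

section \<open>Elementary facts on unit vectors, edges and vertices\<close>

lemma unit_inner_ge_1_imp_eq:
  fixes x y :: "'a::real_inner"
  assumes "norm x = 1" "norm y = 1" "x \<bullet> y \<ge> 1"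
  shows "x = y"
proof -
  have "(norm (x - y))\<^sup>2 = 2 - 2 * (x \<bullet> y)"
    using assms unfolding power2_norm_eq_inner
    by (simp add: inner_diff_left inner_diff_right inner_commute norm_eq_1)
  then have "(norm (x - y))\<^sup>2 \<le> 0" using assms by simp
  then show ?thesis by simp
qed

lemma is_edge_endpoints_distinct: "is_edge P (closed_segment v w) \<Longrightarrow> v \<noteq> w"
  by (auto simp: is_edge_def)

lemma vertex_in_edge_is_endpoint:
  assumes P: "polytope P" "interior P \<noteq> {}" and x: "is_vertex P x"
    and e: "x \<in> closed_segment y z" "closed_segment y z \<subseteq> P"
  shows "x = y \<or> x = z"
proof -
  have "x extreme_point_of P"
    using x supp_face_iff[OF P] by (simp add: is_vertex_def face_of_singleton)
  then have "x \<notin> open_segment y z"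
    using e by (auto simp: extreme_point_of_def)
  then show ?thesis using e by (auto simp: open_segment_def)
qed

section \<open>The theorem\<close>

theorem theorem3p1:
  fixes P F :: "(real^3) set"
    and v :: "real^3"
    and k :: nat
    and a :: "nat \<Rightarrow> real^3"
    and i :: "nat \<Rightarrow> nat"
    and w :: "nat \<Rightarrow> nat \<Rightarrow> real^3"
    and G :: "nat \<Rightarrow> nat \<Rightarrow> (real^3) set"
  assumes "polytope P" and "reduced_body P"
    and "k > 0" and "\<forall>j\<in>{1..k}. i j > 0"
    and "is_facet P F"
    and "a 0 = a k"
    and "bij_betw a {1..k} {x \<in> F. is_vertex P x}"
    and "bij_betw (\<lambda>j. closed_segment (a (j - 1)) (a j)) {1..k} {E. is_edge P E \<and> E \<subseteq> F}"
    and "is_vertex P v"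
    and "bij_betw (\<lambda>(j, l). closed_segment v (w j l)) (SIGMA j:{1..k}. {1..i j})
           {E. is_edge P E \<and> v \<in> E}"
    and "\<forall>j\<in>{1..k}. \<forall>l\<in>{1..<i j}. is_facet P (G j l) \<and>
           closed_segment v (w j l) \<subseteq> G j l \<and> closed_segment v (w j (l + 1)) \<subseteq> G j l"
    and "\<forall>j\<in>{1..<k}. is_facet P (G j (i j)) \<and>
           closed_segment v (w j (i j)) \<subseteq> G j (i j) \<and> closed_segment v (w (j + 1) 1) \<subseteq> G j (i j)"
    and "is_facet P (G k (i k)) \<and>
           closed_segment v (w k (i k)) \<subseteq> G k (i k) \<and> closed_segment v (w 1 1) \<subseteq> G k (i k)"
  shows "\<not> ((strictly_antipodal P F {v} \<and> aff_dist {v} F = min_width P) \<and>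
            (\<forall>j\<in>{1..k}. strictly_antipodal P (closed_segment v (w j 1))
                                               (closed_segment (a (j - 1)) (a j))) \<and>
            (\<forall>j\<in>{1..k}. (\<forall>l\<in>{1..i j}. strictly_antipodal P (G j l) {a j}) \<and>
                         (\<exists>l\<in>{1..i j}. aff_dist {a j} (G j l) = min_width P)))"
proof
  assume "(strictly_antipodal P F {v} \<and> aff_dist {v} F = min_width P) \<and>
            (\<forall>j\<in>{1..k}. strictly_antipodal P (closed_segment v (w j 1))
                                               (closed_segment (a (j - 1)) (a j))) \<and>
            (\<forall>j\<in>{1..k}. (\<forall>l\<in>{1..i j}. strictly_antipodal P (G j l) {a j}) \<and>
                         (\<exists>l\<in>{1..i j}. aff_dist {a j} (G j l) = min_width P))"
  then have a1: "strictly_antipodal P F {v}" and a2: "aff_dist {v} F = min_width P"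
    and b: "\<And>j. j \<in> {1..k} \<Longrightarrow> strictly_antipodal P (closed_segment v (w j 1)) (closed_segment (a (j - 1)) (a j))"
    and c1: "\<And>j l. j \<in> {1..k} \<Longrightarrow> l \<in> {1..i j} \<Longrightarrow> strictly_antipodal P (G j l) {a j}"
    and c2: "\<And>j. j \<in> {1..k} \<Longrightarrow> \<exists>l\<in>{1..i j}. aff_dist {a j} (G j l) = min_width P"
    by auto
  define \<omega> where "\<omega> = min_width P"
  define S where "S = (SIGMA j:{1..k}. {1..i j})"
  define W where "W = (\<lambda>(j, l). w j l)"
  define nx where "nx = next_index k i"
  have pos: "\<And>j. j \<in> {1..k} \<Longrightarrow> i j > 0" and k0: "k > 0" using assms(3,4) by auto
  have P: "polytope P" "interior P \<noteq> {}" and cP: "compact P" "convex P" and P0: "P \<noteq> {}"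
    using assms(1,2) by (auto simp: reduced_body_def convex_body_def)
  have \<omega>0: "\<omega> \<ge> 0" unfolding \<omega>_def by (rule min_width_nonneg[OF cP(1) P0])

  have edgesF: "is_edge P (closed_segment (a (j - 1)) (a j))" if "j \<in> {1..k}" for j
    using bij_betwE[OF assms(8)] that by auto
  have inj_edges: "inj_on (\<lambda>j. closed_segment (a (j - 1)) (a j)) {1..k}"
    using assms(8) by (rule bij_betw_imp_inj_on)
  have inj_a: "inj_on a {1..k}" using assms(7) by (rule bij_betw_imp_inj_on)
  have aF: "a j \<in> F" "is_vertex P (a j)" if "j \<in> {1..k}" for j
    using bij_betwE[OF assms(7)] that by auto
  \<comment> \<open>Because \<open>a 0 = a k\<close>, the only edge would degenerate to a point for
    \<open>k = 1\<close>, and the two edges would coincide for \<open>k = 2\<close>.\<close>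
  have k3: "k \<ge> 3"
  proof -
    have "k \<noteq> 1"
      using edgesF[of 1] assms(6) by (auto simp: is_edge_def)
    moreover have "k \<noteq> 2"
    proof
      assume "k = 2"
      then have "(1::nat) = 2"
        using inj_onD[OF inj_edges, of 1 2] assms(6) by (auto simp: closed_segment_commute)
      then show False by simp
    qed
    ultimately show ?thesis using k0 by linarith
  qed

  have edgesv: "is_edge P (closed_segment v (W x))" if "x \<in> S" for x
    using bij_betwE[OF assms(10)] that by (auto simp: S_def W_def)
  have inj_W: "x = y" if "x \<in> S" "y \<in> S" "closed_segment v (W x) = closed_segment v (W y)" for x y
    by (rule inj_onD[OF bij_betw_imp_inj_on[OF assms(10)]])
      (use that in \<open>simp_all add: S_def W_def case_prod_unfold\<close>)
  have edge_P: "closed_segment v (W x) \<subseteq> P" if "x \<in> S" for x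
    using edgesv[OF that] by (auto simp: is_edge_def supp_face_def)
  have Wv: "W x \<in> P" "W x \<noteq> v" if "x \<in> S" for x
    using edge_P[OF that] edgesv[OF that] by (auto dest: is_edge_endpoints_distinct)
  have nxS: "nx x \<in> S" if "x \<in> S" for x
    using next_index_mem[of k i, OF k0 pos] that unfolding nx_def S_def by blast
  have facets: "closed_segment v (W x) \<subseteq> case_prod G x" "closed_segment v (W (nx x)) \<subseteq> case_prod G x"
    if xS: "x \<in> S" for x
  proof -
    obtain j l where x: "x = (j, l)" "j \<in> {1..k}" "l \<in> {1..i j}" using xS by (auto simp: S_def)
    consider "l < i j" | "l = i j" "j < k" | "l = i j" "j = k" using x by force
    then have "closed_segment v (W x) \<subseteq> case_prod G x \<and> closed_segment v (W (nx x)) \<subseteq> case_prod G x"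
    proof cases
      case 1 then show ?thesis using assms(11) x by (auto simp: W_def nx_def)
    next
      case 2 then show ?thesis using assms(12) x by (auto simp: W_def nx_def)
    next
      case 3 then show ?thesis using assms(13) x by (auto simp: W_def nx_def)
    qed
    then show "closed_segment v (W x) \<subseteq> case_prod G x" "closed_segment v (W (nx x)) \<subseteq> case_prod G x"
      by auto
  qed

  \<comment> \<open>Normals of the antipodal pairs and the foot of the perpendicular from
    \<open>v\<close>\<close>
  obtain u0 where u0: "antipodal_normal P F {v} u0" using strictly_antipodal_normal[OF a1] by blast
  note U0 = antipodal_normalD[OF cP(1) P0 u0]
  define p where "p = v + \<omega> *\<^sub>R u0"
  have pF: "p \<in> F" unfolding p_def \<omega>_def by (rule antipodal_foot[OF cP P0 u0 a2])
  obtain nn where nn: "\<And>j. j \<in> {1..k} \<Longrightarrow>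
      antipodal_normal P (closed_segment v (w j 1)) (closed_segment (a (j - 1)) (a j)) (nn j)"
    using strictly_antipodal_normal[OF b] by metis
  obtain uu where uu: "\<And>x. x \<in> S \<Longrightarrow> antipodal_normal P (case_prod G x) {a (fst x)} (uu x)"
  proof -
    have "\<exists>u. antipodal_normal P (case_prod G x) {a (fst x)} u" if "x \<in> S" for x
      using that c1 by (auto simp: S_def intro!: strictly_antipodal_normal)
    then show ?thesis using that by metis
  qed
  note NN = antipodal_normalD[OF cP(1) P0 nn]
  note UU = antipodal_normalD[OF cP(1) P0 uu]

  \<comment> \<open>Otherwise \<open>v = p\<close> lies in \<open>F\<close>; then \<open>u0\<close>
    is constant on \<open>F\<close> with its minimum over \<open>P\<close>, attained only at
    \<open>v\<close>, and \<open>F\<close> collapses to a point.\<close>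
  have \<omega>pos: "\<omega> > 0"
  proof (rule ccontr)
    assume "\<not> \<omega> > 0"
    then have "p = v" using \<omega>0 by (simp add: p_def)
    have "x = v" if "x \<in> F" for x
      using U0(9)[of v x] U0(6)[of x v] U0(2) that pF \<open>p = v\<close> by force
    then have "a 1 = a 2" using aF[of 1] aF[of 2] k3 by auto
    then show False using inj_onD[OF inj_a, of 1 2] k3 by auto
  qed
  \<comment> \<open>If \<open>p\<close> were on the edge, the segment from \<open>p\<close> to
    \<open>v\<close> of length \<open>\<omega>\<close> would span at least the minimum width in
    direction \<open>nn j\<close>. Equality in Cauchy-Schwarz gives \<open>nn j = - u0\<close>,
    whose face is \<open>{v}\<close> and not an edge.\<close>
  have p_edge: "p \<notin> closed_segment (a (j - 1)) (a j)" if j: "j \<in> {1..k}" for j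
  proof
    assume "p \<in> closed_segment (a (j - 1)) (a j)"
    then have "\<omega> \<le> nn j \<bullet> (v - p)"
      unfolding \<omega>_def using NN(10)[OF j, of v p] by simp
    then have "\<omega> * 1 \<le> \<omega> * (nn j \<bullet> (- u0))" by (simp add: p_def)
    then have "nn j \<bullet> (- u0) \<ge> 1" using \<omega>pos by (simp only: mult_le_cancel_left_pos)
    then have "nn j = - u0" using unit_inner_ge_1_imp_eq[of "nn j" "- u0"] NN(1)[OF j] U0(1) by simp
    then have "closed_segment v (w j 1) = {v}"
      using nn[OF j] u0 by (simp add: antipodal_normal_def)
    then have "w j 1 = v" by (metis ends_in_segment(2) singletonD)
    then show False using Wv(2)[of "(j, 1)"] j pos[OF j] by (auto simp: S_def W_def)
  qed

  have a_mem: "a j \<in> F" "p \<noteq> a j" if "j \<le> k" for j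
  proof -
    have "a j \<in> F \<and> p \<noteq> a j" if "j \<in> {1..k}" for j
      using aF(1)[OF that] p_edge[OF that] by auto
    from this[of j] this[of k] show "a j \<in> F" "p \<noteq> a j"
      using that assms(6) k0 by (cases "j = 0"; force)+
  qed
  \<comment> \<open>Pythagoras in the triangle \<open>v\<close>, \<open>p\<close>,
    \<open>a j\<close> with its right angle at \<open>p\<close>.\<close>
  have norms: "(norm (a j - p))\<^sup>2 = (norm (a j - v))\<^sup>2 - \<omega>\<^sup>2" if "j \<le> k" for j
  proof -
    have "u0 \<bullet> (a j - p) = 0" using U0(6) a_mem(1)[OF that] pF by blast
    then have "(norm ((a j - p) + \<omega> *\<^sub>R u0))\<^sup>2 = (norm (a j - p))\<^sup>2 + \<omega>\<^sup>2"
      using U0(1) unfolding power2_norm_eq_inner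
      by (simp add: inner_add_left inner_add_right inner_commute norm_eq_1 power2_eq_square)
    moreover have "(a j - p) + \<omega> *\<^sub>R u0 = a j - v" by (simp add: p_def)
    ultimately show ?thesis by simp
  qed

  define \<tau> where "\<tau> j = tangent_angle \<omega> (a j - v)" for j
  \<comment> \<open>The normal \<open>nn j\<close> from (b) is orthogonal to the edge at
    \<open>v\<close> and takes equal values at \<open>a (j - 1)\<close> and \<open>a j\<close>, at
    least \<open>\<omega>\<close> away from its value at \<open>v\<close>.\<close>
  have base: "vangle (a (j - 1) - p) (a j - p) \<le> \<tau> (j - 1) (W (j, 1) - v) + \<tau> j (W (j, 1) - v)"
    if j: "j \<in> {1..k}" for j
    unfolding \<tau>_def
  proof (rule vangle_le_tangent_angles)
    show "norm (nn j) = 1" using NN(1)[OF j] .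
    have w1: "\<omega> \<le> nn j \<bullet> (v - a (j - 1))" unfolding \<omega>_def using NN(10)[OF j] by simp
    then show "\<omega> \<le> \<bar>nn j \<bullet> (a (j - 1) - v)\<bar>" by (simp add: inner_diff_right)
    show "nn j \<bullet> (a (j - 1) - v) = nn j \<bullet> (a j - v)"
      using NN(7)[OF j, of "a (j - 1)" "a j"] by (simp add: inner_diff_right)
    show "nn j \<bullet> (W (j, 1) - v) = 0"
      using NN(6)[OF j, of "w j 1" v] by (simp add: W_def)
    show "(norm (a (j - 1) - p))\<^sup>2 = (norm (a (j - 1) - v))\<^sup>2 - \<omega>\<^sup>2"
      "(norm (a j - p))\<^sup>2 = (norm (a j - v))\<^sup>2 - \<omega>\<^sup>2" using norms j by auto
  qed (use \<omega>0 in auto)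

  define A where "A x = vangle (W x - v) (W (nx x) - v)" for x
  \<comment> \<open>The plane of each facet contains both edge directions and is at distance at
    least \<open>\<omega>\<close> from its antipodal vertex, as required for tangent angles.\<close>
  have uuW: "norm (uu x) = 1" "uu x \<bullet> (W x - v) = 0" "uu x \<bullet> (W (nx x) - v) = 0"
    "\<omega> \<le> \<bar>uu x \<bullet> (a (fst x) - v)\<bar>" if "x \<in> S" for x
  proof -
    have v: "v \<in> case_prod G x" "W x \<in> case_prod G x" "W (nx x) \<in> case_prod G x"
      using facets[OF that] by auto
    show "norm (uu x) = 1" using UU(1)[OF that] .
    show "uu x \<bullet> (W x - v) = 0" "uu x \<bullet> (W (nx x) - v) = 0" using UU(6)[OF that] v by auto
    have "\<omega> \<le> uu x \<bullet> (v - a (fst x))" unfolding \<omega>_def using UU(10)[OF that] v by auto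
    then show "\<omega> \<le> \<bar>uu x \<bullet> (a (fst x) - v)\<bar>" by (simp add: inner_diff_right)
  qed

  \<comment> \<open>The face angles at \<open>v\<close> sum to less than a full angle\<close>
  define n where "n = (\<Sum>x = 1..k. i x)"
  define cy where "cy = cyc_index k i"
  have cyS: "cy m \<in> S" for m
    unfolding cy_def S_def by (rule cyc_index_mem[of k i, OF k0 pos])
  have cyper: "cy (m + n) = cy m" for m
    unfolding cy_def n_def by (rule cyc_index_period[of k i, OF k0 pos])
  have cySuc: "cy (Suc m) = nx (cy m)" for m by (simp add: cy_def nx_def cyc_index_Suc)
  have cybij: "bij_betw cy {..<n} S"
    unfolding cy_def S_def n_def by (rule bij_betw_cyc_index[of k i, OF k0 pos])
  have n3: "n \<ge> 3"
  proof -
    have "(\<Sum>x = 1..k. 1) \<le> (\<Sum>x = 1..k. i x)" by (rule sum_mono) (use pos in \<open>force simp: Suc_le_eq\<close>)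
    then show ?thesis using k3 by (simp add: n_def)
  qed
  have cyeq: "x mod n = y mod n" if "cy x = cy y" for x y
  proof -
    have "cy (x mod n) = cy (y mod n)" using that periodic_mod[of cy n, OF cyper] by simp
    then show ?thesis using bij_betw_imp_inj_on[OF cybij] n3 by (auto dest: inj_onD)
  qed
  have mod_Suc_ne: "Suc m mod n \<noteq> m mod n" for m using n3 by (auto simp: mod_Suc)
  have W_ne: "closed_segment v (W x) \<noteq> closed_segment v (W (nx x))" if xS: "x \<in> S" for x
  proof -
    obtain m where "x = cy m" using xS bij_betw_imp_surj_on[OF cybij] by auto
    then have "x \<noteq> nx x" using cyeq[of "Suc m" m] mod_Suc_ne[of m] by (auto simp: cySuc)
    then show ?thesis using inj_W[OF xS nxS[OF xS]] by blast
  qed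

  have "(\<Sum>m<n. vangle (W (cy m) - v) (W (cy (Suc m)) - v)) < 2 * pi"
  proof (rule face_angle_sum_less_2pi[of n _ u0 "\<lambda>m. uu (cy m)"])
    show "0 < u0 \<bullet> (W (cy m) - v)" for m using U0(9)[of v] Wv[OF cyS] by simp
    show "uu (cy m) \<bullet> (W (cy x) - v) < 0" if "x mod n \<noteq> m mod n" "x mod n \<noteq> Suc m mod n" for m x
    proof -
      have "cy x \<noteq> cy m" "cy x \<noteq> nx (cy m)" using that cyeq[of x m] cyeq[of x "Suc m"] by (auto simp: cySuc)
      then have "uu (cy m) \<bullet> (W (cy x) - v) \<noteq> 0"
        using third_edge_not_in_facet_plane[OF P edgesv edgesv edgesv, of "cy m" "nx (cy m)" "cy x" "uu (cy m)"]
          W_ne[OF cyS] inj_W cyS nxS uuW[OF cyS] by (metis norm_zero zero_neq_one)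
      moreover have "v \<in> case_prod G (cy m)" by (rule subsetD[OF facets(1)[OF cyS] ends_in_segment(1)])
      ultimately show ?thesis
        using UU(6)[OF cyS, of "W (cy x)" m v] UU(8)[OF cyS, of v m "W (cy x)"] Wv(1)[OF cyS[of x]] by metis
    qed
  qed (use n3 cyper U0(1) uuW[OF cyS] in \<open>auto simp: cySuc\<close>)
  then have "(\<Sum>m<n. A (cy m)) < 2 * pi" by (simp add: A_def cySuc)
  then have sumA: "sum A S < 2 * pi" using sum.reindex_bij_betw[OF cybij, of A] by simp

  have chain: "\<tau> j (W (j, 1) - v) + \<tau> j (W (nx (j, i j)) - v) \<le> (\<Sum>l = 1..i j. A (j, l))"
    if j: "j \<in> {1..k}" for j
  proof -
    \<comment> \<open>Past the end of block \<open>j\<close> the value is the first edge of the next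
      block, so block \<open>j\<close> becomes one chain of directions indexed from 1 to
      \<open>i j + 1\<close>.\<close>
    define g where "g l = (if l \<le> i j then W (j, l) else W (nx (j, i j))) - v" for l
    have jS: "(j, l) \<in> S" if "l \<in> {1..i j}" for l using j that by (auto simp: S_def)
    have g: "g l = W (j, l) - v" "g (Suc l) = W (nx (j, l)) - v" if "l \<in> {1..i j}" for l
      using that by (auto simp: g_def nx_def le_less Suc_le_eq)
    have Ag: "A (j, l) = vangle (g l) (g (Suc l))" if "l \<in> {1..i j}" for l
      using g[OF that] by (simp add: A_def)
    obtain l where l: "l \<in> {1..i j}" "aff_dist {a j} (G j l) = min_width P" using c2[OF j] by blast
    have "\<tau> j (g 1) + \<tau> j (g (Suc (i j))) \<le> (\<Sum>l = 1..i j. A (j, l))"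
    proof (rule chain_endpoints_le_sum[of l])
      show "l \<in> {1..i j}" by fact
      fix m assume m: "m \<in> {1..i j}"
      show "\<tau> j (g m) \<le> A (j, m) + \<tau> j (g (Suc m))"
        unfolding Ag[OF m] \<tau>_def
        by (rule tangent_angle_lipschitz[of "uu (j, m)"]) (use uuW[OF jS[OF m]] g[OF m] \<omega>0 in auto)
      show "\<tau> j (g (Suc m)) \<le> A (j, m) + \<tau> j (g m)"
        unfolding Ag[OF m] \<tau>_def vangle_commute[of "g m"]
        by (rule tangent_angle_lipschitz[of "uu (j, m)"]) (use uuW[OF jS[OF m]] g[OF m] \<omega>0 in auto)
    next
      let ?u = "uu (j, l)"
      have x: "(j, l) \<in> S" using jS[OF l(1)] .
      define y where "y = a j + \<omega> *\<^sub>R ?u"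
      have "antipodal_normal P (G j l) {a j} ?u" using uu[OF x] by simp
      then have y: "y \<in> G j l" unfolding y_def \<omega>_def
        using l(2) by (rule antipodal_foot[OF cP P0])
      have vG: "v \<in> G j l" using subsetD[OF facets(1)[OF x] ends_in_segment(1)] by simp
      \<comment> \<open>Since \<open>y\<close> is where the plane of the facet touches the sphere
        about \<open>a j\<close>, the tangent angle of \<open>d\<close> is 0. As \<open>y\<close>
        lies in the facet, \<open>d\<close> splits the facet angle, and both tangent angles are
        bounded by the parts.\<close>
      define d where "d = y - v"
      have ud: "?u \<bullet> d = 0" unfolding d_def using UU(6)[OF x] y vG by simp
      have dc: "d = (a j - v) + \<omega> *\<^sub>R ?u" by (simp add: d_def y_def)
      have uc: "?u \<bullet> (a j - v) = - \<omega>"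
        using ud uuW(1)[OF x] unfolding dc by (simp add: inner_add_right norm_eq_1)
      have nd: "(norm d)\<^sup>2 = (norm (a j - v))\<^sup>2 - \<omega>\<^sup>2"
        using uc uuW(1)[OF x] unfolding dc power2_norm_eq_inner
        by (simp add: inner_add_left inner_add_right inner_commute[of "a j - v" ?u] norm_eq_1
            power2_eq_square del: inner_diff_left inner_diff_right)
      have dd: "d \<bullet> (a j - v) = (norm d)\<^sup>2"
        using uc unfolding nd unfolding dc power2_norm_eq_inner
        by (simp add: inner_add_left power2_eq_square del: inner_diff_left inner_diff_right)
      have "(norm d)\<^sup>2 = (norm (a j - p))\<^sup>2" using nd norms[of j] j by simp
      then have d0: "d \<noteq> 0" using a_mem(2)[of j] j by auto
      have t0: "\<tau> j d = 0" unfolding \<tau>_def by (rule tangent_angle_touching[OF nd dd d0])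
      have "?u \<noteq> 0" using uuW(1)[OF x] by auto
      then obtain s t where st: "0 \<le> s" "0 \<le> t"
        "y - v = s *\<^sub>R (W (j, l) - v) + t *\<^sub>R (W (nx (j, l)) - v)"
        using facet_in_cone_of_edges[OF P edgesv[OF x] edgesv[OF nxS[OF x]] W_ne[OF x], of ?u y]
          uuW(2,3)[OF x] ud y UU(2)[OF x] unfolding d_def by auto
      have add: "vangle (g l) d + vangle d (g (Suc l)) \<le> A (j, l)"
        using vangle_cone_le[of "W (j, l) - v" "W (nx (j, l)) - v" s t] st d0 Wv(2)[OF x] Wv(2)[OF nxS[OF x]]
        by (simp add: g[OF l(1)] A_def d_def)
      have "\<tau> j (g l) \<le> vangle (g l) d + \<tau> j d" "\<tau> j (g (Suc l)) \<le> vangle (g (Suc l)) d + \<tau> j d"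
        unfolding \<tau>_def
        by (rule tangent_angle_lipschitz[of ?u]; use uuW[OF x] g[OF l(1)] \<omega>0 ud in auto)+
      then show "\<tau> j (g l) + \<tau> j (g (Suc l)) \<le> A (j, l)"
        using add t0 by (simp add: vangle_commute)
    qed
    moreover have "g 1 = W (j, 1) - v" "g (Suc (i j)) = W (nx (j, i j)) - v"
      using pos[OF j] by (auto simp: g_def)
    ultimately show ?thesis by simp
  qed

  \<comment> \<open>The full angle around the foot \<open>p\<close> and the final summation\<close>
  define a' where "a' m = a (m mod k)" for m
  have a'Suc: "a' (Suc m) = a (Suc (m mod k))" for m
    using assms(6) by (auto simp: a'_def mod_Suc)
  have jm: "Suc (m mod k) \<in> {1..k}" for m using k0 by (simp add: Suc_le_eq)
  have a'_inj: "x mod k = y mod k" if "a' x = a' y" for x y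
  proof -
    \<comment> \<open>Injectivity of \<open>a\<close> is known on \<open>{1..k}\<close>, so residue
      0 is represented by \<open>k\<close>.\<close>
    define r where "r x = (if x mod k = 0 then k else x mod k)" for x
    have r: "a' x = a (r x)" "r x \<in> {1..k}" for x
      using assms(6) k0 by (auto simp: a'_def r_def less_imp_le)
    then have "r x = r y" using inj_onD[OF inj_a] that by metis
    then show ?thesis using mod_less_divisor[OF k0, of x] mod_less_divisor[OF k0, of y]
      unfolding r_def by (metis less_irrefl)
  qed
  have a'F: "a' m \<in> F" "is_vertex P (a' m)" for m
  proof -
    show "a' m \<in> F" using a_mem(1)[of "m mod k"] k0 by (simp add: a'_def less_imp_le)
    show "is_vertex P (a' m)"
      using aF(2)[of "m mod k"] aF(2)[of k] assms(6) k0
      by (cases "m mod k = 0") (auto simp: a'_def less_imp_le)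
  qed
  have "2 * pi \<le> (\<Sum>m<k. vangle (a' m - p) (a' (Suc m) - p))"
  \<comment> \<open>The edge of \<open>F\<close> is on the minimising side of \<open>nn\<close>,
    hence the minus sign for the outer normal.\<close>
  proof (rule polygon_angle_sum_ge_2pi[of k _ u0 _ "\<lambda>m. - nn (Suc (m mod k))"])
    show "a' (m + k) = a' m" for m by (simp add: a'_def)
    show "u0 \<bullet> (a' m - p) = 0" for m using U0(6)[OF a'F(1) pF] .
    have e: "closed_segment (a (Suc (m mod k) - 1)) (a (Suc (m mod k))) = closed_segment (a' m) (a' (Suc m))" for m
      by (simp add: a'Suc) (simp add: a'_def)
    note N = NN[OF jm, unfolded e]
    show "- nn (Suc (m mod k)) \<bullet> (a' (Suc m) - a' m) = 0" for m using N(7)[of "a' (Suc m)" m "a' m"] by simp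
    show "- nn (Suc (m mod k)) \<bullet> (a' x - a' m) < 0" if "x mod k \<noteq> m mod k" "x mod k \<noteq> Suc m mod k" for m x
    proof -
      have "a' x \<notin> closed_segment (a' m) (a' (Suc m))"
        using vertex_in_edge_is_endpoint[OF P a'F(2) _ N(3)] a'_inj that by metis
      then show ?thesis using N(9)[of "a' m" m "a' x"] a'F(1)[of x] U0(2) by auto
    qed
    show "- nn (Suc (m mod k)) \<bullet> (p - a' m) < 0" for m
      using N(9)[of "a' m" m p] p_edge[OF jm, unfolded e] pF U0(2) by auto
  qed (use k3 U0(1) in auto)
  also have "\<dots> = (\<Sum>m<k. vangle (a m - p) (a (Suc m) - p))"
    by (rule sum.cong) (auto simp: a'Suc, simp add: a'_def)
  also have "\<dots> \<le> (\<Sum>m<k. \<tau> m (W (Suc m, 1) - v) + \<tau> (Suc m) (W (Suc m, 1) - v))"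
    by (rule sum_mono) (use base[of "Suc _"] in auto)
  also have "\<dots> = (\<Sum>m<k. \<tau> (Suc m) (W (Suc m, 1) - v) + \<tau> (Suc m) (W (nx (Suc m, i (Suc m))) - v))"
  proof -
    \<comment> \<open>The first tangent angle at the edge \<open>W (Suc m, 1)\<close> belongs to the
      sphere about \<open>a m\<close> and moves to block \<open>m\<close>, whose successor block
      starts with that edge. At \<open>m = k\<close> the successor is block 1, and
      \<open>q 0 = q k\<close> as \<open>a 0 = a k\<close>.\<close>
    define q where "q m = \<tau> m (W (if m < k then Suc m else 1, 1) - v)" for m
    have "q 0 + (\<Sum>m<k. q (Suc m)) = (\<Sum>m<k. q m) + q k"
      by (metis sum.lessThan_Suc sum.lessThan_Suc_shift)
    moreover have "q 0 = q k" using k0 assms(6) by (simp add: q_def \<tau>_def)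
    ultimately have "(\<Sum>m<k. q m) = (\<Sum>m<k. q (Suc m))" by simp
    moreover have "(\<Sum>m<k. q m) = (\<Sum>m<k. \<tau> m (W (Suc m, 1) - v))"
      by (rule sum.cong) (auto simp: q_def)
    moreover have "(\<Sum>m<k. q (Suc m)) = (\<Sum>m<k. \<tau> (Suc m) (W (nx (Suc m, i (Suc m))) - v))"
      by (rule sum.cong) (auto simp: q_def nx_def)
    ultimately show ?thesis by (simp add: sum.distrib)
  qed
  also have "\<dots> \<le> (\<Sum>m<k. \<Sum>l = 1..i (Suc m). A (Suc m, l))"
    by (rule sum_mono) (use chain in auto)
  also have "\<dots> = (\<Sum>j = 1..k. \<Sum>l = 1..i j. A (j, l))"
    by (simp add: sum.atLeast1_atMost_eq)
  also have "\<dots> = sum A S" unfolding S_def by (subst sum.Sigma) (auto simp: case_prod_unfold)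
  finally show False using sumA by simp
qed

end
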